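(* Let $q$ be an odd prime power, let $m\ge 3$ be odd, and let $n=(q^m-1)/2$. Then the negacyclic code $\mathcal{C}_{(1,n)}$ over $\mathrm{GF}(q)$ has length $(q^m-1)/2$, dimension $[q^m+(2-q)^m-2]/4$, and minimum distance $$d\ \ge\ q^{(m-1)/2}+1+\epsilon ,$$ where $\epsilon=0$ if $q=3$ and $\epsilon=q-2$ if $q\ge 5$. The dual code $\mathcal{C}_{(1,n)}^\perp$ has length $(q^m-1)/2$, dimension $[q^m-(2-q)^m]/4$, and minimum distance $$d^\perp\ \ge\ (q-1)q^{(m-3)/2}+1 .$$
   Context: Let $q$ be an odd prime power, $m\ge 2$ an integer, $N=q^m-1$, $n=N/2$. For $0\le h\le q^m-1$ with $q$-adic expansion $h=\sum_{j=0}^{m-1}h_jq^j$, $0\le h_j\le q-1$, let $\mathtt{wt}(h)$ be the number of indices $j$ with $h_j\ne 0$. Let $\Omega=\{1+2i: 0\le i\le n-1\}$ (the odd residues modulo $N$) and, for $i\in\{0,1\}$, let $T_{(i,n)}=\{h\in\Omega: \mathtt{wt}(h)\equiv i \pmod 2\}$; this set is closed under multiplication by $q$ modulo $N$. A linear code of length $n$ over $\mathrm{GF}(q)$ is identified with a subspace of $\mathrm{GF}(q)[x]/(x^n+1)$ via $(c_0,\dots,c_{n-1})\mapsto \sum_j c_jx^j$; it is negacyclic if it is an ideal there, and its generator polynomial is then the monic divisor of $x^n+1$ generating it. Fix a primitive element $\beta$ of $\mathrm{GF}(q^m)$, so $\beta^n=-1$ and the roots of $x^n+1$ are $\beta^i$,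 $i\in\Omega$. The negacyclic code with defining set $Z\subseteq\Omega$ is the one with generator polynomial $\prod_{i\in Z}(x-\beta^i)$. $\mathcal{C}_{(i,n)}$ is the negacyclic code of length $n$ over $\mathrm{GF}(q)$ with defining set $T_{(i,n)}$. Minimum distance is Hamming distance, and $\mathcal{C}^\perp$ is the dual with respect to the standard (Euclidean) inner product on $\mathrm{GF}(q)^n$. *)

theory Defs
  imports
    "Jordan_Normal_Form.VS_Connect"
    "HOL-Algebra.QuotRing"
    "HOL-Computational_Algebra.Primes"
    "HOL-Library.Cardinality"
begin

definition linear_code :: "nat \<Rightarrow> 'a::field vec set \<Rightarrow> bool" where
  "linear_code n C \<longleftrightarrow> VectorSpace.subspace class_ring C (module_vec TYPE('a) n)"

definition code_dim :: "nat \<Rightarrow> 'a::field vec set \<Rightarrow> nat" where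
  "code_dim n C = vectorspace.dim class_ring ((module_vec TYPE('a) n)\<lparr>carrier := C\<rparr>)"

definition hamming_distance :: "'a vec \<Rightarrow> 'a vec \<Rightarrow> nat" where
  "hamming_distance u v = card {i. i < dim_vec u \<and> u $ i \<noteq> v $ i}"

text \<open>Only meaningful for codes with at least two codewords; otherwise \<^const>\<open>Min\<close>
  is applied to the empty set and its value is unspecified.\<close>

definition min_distance :: "'a vec set \<Rightarrow> nat" where
  "min_distance C = Min {hamming_distance u v | u v. u \<in> C \<and> v \<in> C \<and> u \<noteq> v}"

definition dual_code :: "nat \<Rightarrow> 'a::field vec set \<Rightarrow> 'a vec set" where
  "dual_code n C = {v \<in> carrier_vec n. \<forall>c \<in> C. v \<bullet> c = 0}"

text \<open>For a polynomial type, \<^term>\<open>class_ring\<close> is the polynomial ring as a ring record.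
  The ring below is its quotient by the principal ideal of \<open>x^n + 1\<close>; its elements
  are cosets, i.e. sets of polynomials.\<close>

definition negacyclic_ideal :: "nat \<Rightarrow> 'a::field poly set" where
  "negacyclic_ideal n = genideal class_ring {monom 1 n + 1}"

definition negacyclic_ring :: "nat \<Rightarrow> 'a::field poly set ring" where
  "negacyclic_ring n = class_ring Quot negacyclic_ideal n"

definition residue_class :: "nat \<Rightarrow> 'a::field poly \<Rightarrow> 'a poly set" where
  "residue_class n f = negacyclic_ideal n +>\<^bsub>class_ring\<^esub> f"

definition codeword_poly :: "nat \<Rightarrow> 'a::field vec \<Rightarrow> 'a poly" where
  "codeword_poly n c = (\<Sum>j<n. monom (c $ j) j)"

definition negacyclic_code :: "nat \<Rightarrow> 'a::field vec set \<Rightarrow> bool" where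
  "negacyclic_code n C \<longleftrightarrow> linear_code n C \<and>
     ideal ((\<lambda>c. residue_class n (codeword_poly n c)) ` C) (negacyclic_ring n)"

definition code_generated_by :: "nat \<Rightarrow> 'a::field poly \<Rightarrow> 'a vec set" where
  "code_generated_by n g = {c \<in> carrier_vec n.
     residue_class n (codeword_poly n c) \<in> genideal (negacyclic_ring n) {residue_class n g}}"

definition primitive_element :: "'b::field \<Rightarrow> bool" where
  "primitive_element \<beta> \<longleftrightarrow> \<beta> \<noteq> 0 \<and> (\<forall>x. x \<noteq> 0 \<longrightarrow> (\<exists>k::nat. x = \<beta> ^ k))"

text \<open>The embedding \<open>\<phi>\<close> of the base field into the extension field containing \<open>\<beta>\<close>
  plays the role of the inclusion. At most one polynomial over the base field maps to the given
  product, since \<open>\<phi>\<close> is injective; one exists whenever \<open>Z\<close> is a set of residues modulo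
  the order of \<open>\<beta>\<close> that is closed under multiplication by the size of the base field.\<close>

definition generator_poly :: "('a::field \<Rightarrow> 'b::field) \<Rightarrow> 'b \<Rightarrow> nat set \<Rightarrow> 'a poly" where
  "generator_poly \<phi> \<beta> Z = (THE g. map_poly \<phi> g = (\<Prod>i\<in>Z. [:- (\<beta> ^ i), 1:]))"

definition code_with_defining_set ::
    "nat \<Rightarrow> ('a::field \<Rightarrow> 'b::field) \<Rightarrow> 'b \<Rightarrow> nat set \<Rightarrow> 'a vec set" where
  "code_with_defining_set n \<phi> \<beta> Z = code_generated_by n (generator_poly \<phi> \<beta> Z)"

definition wt :: "nat \<Rightarrow> nat \<Rightarrow> nat \<Rightarrow> nat" where
  "wt q m h = card {j. j < m \<and> (h div q ^ j) mod q \<noteq> 0}"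

definition Omega :: "nat \<Rightarrow> nat set" where
  "Omega n = {1 + 2 * i | i. i < n}"

definition T_set :: "nat \<Rightarrow> nat \<Rightarrow> nat \<Rightarrow> nat \<Rightarrow> nat set" where
  "T_set q m i n = {h \<in> Omega n. wt q m h mod 2 = i mod 2}"

definition C_code ::
    "nat \<Rightarrow> ('a::{field,finite} \<Rightarrow> 'b::field) \<Rightarrow> 'b \<Rightarrow> nat \<Rightarrow> nat \<Rightarrow> 'a vec set" where
  "C_code m \<phi> \<beta> i n = code_with_defining_set n \<phi> \<beta> (T_set CARD('a) m i n)"

end

theory Submission
  imports Defs "Jordan_Normal_Form.Char_Poly"
begin

text \<open>
  Write \<open>m = 2k + 1\<close>, \<open>N = q\<^sup>m - 1\<close>, and let \<open>R\<close> be the set of roots of \<open>x\<^sup>n + 1\<close>. The code with set of zeros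
  \<open>S \<subseteq> R\<close> has dimension \<open>n - |S|\<close>, and its dual is the code whose zeros are the inverses of
  \<open>R - S\<close>. The cardinality of \<open>T\<^sub>1\<close> follows from the sums of \<open>(-1)\<^sup>h\<close>, \<open>(-1)\<close> to the \<open>wt h\<close>, and \<open>(-1)\<close>
  to the \<open>h + wt h\<close> over all \<open>h < q\<^sup>m\<close>, which factor over the digits.

  For the distances, apply the BCH bound along arithmetic progressions of step \<open>q\<^sup>k + 1\<close>, whose
  gcd with \<open>N\<close> is \<open>2\<close>. Adding \<open>(q\<^sup>k + 1) a\<close> for \<open>a < q\<^sup>k\<close> writes the digits of \<open>a\<close> twice below the top
  digit, so an odd top digit \<open>c\<close> gives weight \<open>2 wt a + 1\<close>. With \<open>c = 3\<close>, possible when \<open>q \<ge> 5\<close>, the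
  progression extends by \<open>q - 2\<close> further terms to the left. For the dual, adding one to the leading digit of the
  upper copy of \<open>a\<close> keeps the weight even as long as the leading digit of \<open>a\<close> is nonzero.
\<close>

subsection \<open>Digits and weights\<close>

text \<open>Concatenation of digit strings: after division by \<open>q ^ j\<close> with
  \<open>j < k\<close>, the part coming from \<open>y\<close> is still a multiple of
  \<open>q\<close>; from position \<open>k\<close> on only \<open>y\<close> is left.\<close>

lemma wt_append:
  assumes "x < q ^ k" 
  shows "wt q (k + l) (x + q ^ k * y) = wt q k x + wt q l y"
proof -
  \<comment> \<open>The bound on \<open>x\<close> already rules out \<open>q = 0\<close> unless
    \<open>k = 0\<close>.\<close>
  have q: "q > 0 \<or> k = 0" using assms by (cases "q = 0") (auto simp: power_0_left split: if_splits)
  have low: "(x + q ^ k * y) div q ^ j mod q = x div q ^ j mod q" if jk: "j < k" for j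
  proof -
    obtain i where k: "k = Suc (j + i)" using less_imp_Suc_add[OF jk] by blast
    have "q ^ k * y = q ^ j * (q * (q ^ i * y))"
      by (simp add: k power_add ac_simps)
    then have "(x + q ^ k * y) div q ^ j = x div q ^ j + q * (q ^ i * y)"
      using q k by (simp only: div_mult_self2 power_eq_0_iff) simp
    then show ?thesis by simp
  qed
  have high: "(x + q ^ k * y) div q ^ (k + j) mod q = y div q ^ j mod q" for j
    using assms q by (cases "k = 0") (simp_all add: power_add div_mult2_eq)
  have "{j. j < k + l \<and> (x + q ^ k * y) div q ^ j mod q \<noteq> 0}
    = {j. j < k \<and> x div q ^ j mod q \<noteq> 0} \<union> (+) k ` {j. j < l \<and> y div q ^ j mod q \<noteq> 0}"
    (is "?L = ?A \<union> ?B")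
  proof (intro equalityI subsetI)
    fix j assume "j \<in> ?L"
    then show "j \<in> ?A \<union> ?B"
      using low[of j] high[of "j - k"] by (cases "j < k") (auto intro!: image_eqI[of _ _ "j - k"])
  qed (use low high in auto)
  then have "wt q (k + l) (x + q ^ k * y) = card (?A \<union> ?B)" by (simp add: wt_def)
  also have "\<dots> = card ?A + card ?B" by (rule card_Un_disjoint) auto
  also have "card ?B = wt q l y" unfolding wt_def by (rule card_image) simp
  finally show ?thesis by (simp add: wt_def)
qed

lemma wt_digit: 
  assumes "d < q" shows "wt q (Suc 0) d = of_bool (d \<noteq> 0)"
proof -
  have "{j. j < Suc 0 \<and> d div q ^ j mod q \<noteq> 0} = (if d \<noteq> 0 then {0} else {})"
    using assms by auto
  then show ?thesis by (simp add: wt_def)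
qed

lemma wt_Suc: "d < q \<Longrightarrow> wt q (Suc l) (d + q * y) = of_bool (d \<noteq> 0) + wt q l y"
  using wt_append[of d q 1 l y] by (simp add: wt_digit)

lemma wt_Suc_top: "x < q ^ k \<Longrightarrow> d < q \<Longrightarrow> wt q (Suc k) (x + q ^ k * d) = wt q k x + of_bool (d \<noteq> 0)"
  using wt_append[of x q k 1 d] by (simp add: wt_digit)

section \<open>Sign sums that factor over the digits, and the size of the odd-weight set\<close>

lemma sum_digit_split:
  fixes f :: "nat \<Rightarrow> 'c::comm_monoid_add"
  shows "(\<Sum>h<q ^ Suc m. f h) = (\<Sum>y<q ^ m. \<Sum>d<q. f (d + q * y))"
proof -
  have "(\<Sum>y<q ^ m. \<Sum>d<q. f (d + q * y)) = (\<Sum>(y, d)\<in>{..<q ^ m} \<times> {..<q}. f (d + q * y))"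
    by (simp add: sum.cartesian_product)
  also have "\<dots> = (\<Sum>h<q ^ Suc m. f h)"
  proof (rule sum.reindex_bij_witness[of _ "\<lambda>h. (h div q, h mod q)" "\<lambda>(y, d). d + q * y"])
    fix h assume "h \<in> {..<q ^ Suc m}"
    then have h: "h < q ^ m * q" by (simp add: mult.commute)
    then have "q > 0" by (cases q) auto
    then show "(h div q, h mod q) \<in> {..<q ^ m} \<times> {..<q}"
      using h by (auto simp: less_mult_imp_div_less)
  next
    fix a assume "a \<in> {..<q ^ m} \<times> {..<q}"
    then obtain y d where a: "a = (y, d)" "y < q ^ m" "d < q" by auto
    have "d + q * y < q * Suc y" using a by simp
    also have "\<dots> \<le> q * q ^ m" using a by (intro mult_left_mono) auto
    finally show "(case a of (y, d) \<Rightarrow> d + q * y) \<in> {..<q ^ Suc m}" using a by simp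
  qed auto
  finally show ?thesis ..
qed

lemma sum_alternating_nat: "odd q \<Longrightarrow> (\<Sum>d<q. (-1::int) ^ d) = 1"
proof (elim oddE)
  fix k assume "q = 2 * k + 1"
  then show ?thesis by (induction k arbitrary: q) auto
qed

text \<open>Each digit contributes the factor 1 - (q - 1) = 2 - q, since only the digit 0 has sign
  +1.\<close>

lemma sum_alternating_wt: 
  assumes "odd q" shows "(\<Sum>h<q ^ m. (-1::int) ^ wt q m h) = (2 - int q) ^ m"
proof (induction m)
  case (Suc m)
  obtain r where q: "q = Suc r" using assms by (cases q) auto
  have d: "(\<Sum>d<q. (-1::int) ^ of_bool (d \<noteq> 0)) = 2 - int q"
    unfolding q lessThan_Suc_eq_insert_0 by (simp add: sum.reindex)
  have "(-1::int) ^ wt q (Suc m) (d + q * y) = (-1) ^ wt q m y * (-1) ^ of_bool (d \<noteq> 0)"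
    if "d < q" for y d
    using that by (simp add: wt_Suc power_add)
  then have "(\<Sum>h<q ^ Suc m. (-1::int) ^ wt q (Suc m) h)
    = (\<Sum>y<q ^ m. \<Sum>d<q. (-1) ^ wt q m y * (-1) ^ of_bool (d \<noteq> 0))"
    unfolding sum_digit_split by (intro sum.cong refl) simp
  also have "\<dots> = (2 - int q) ^ Suc m"
    unfolding sum_distrib_left[symmetric] d sum_distrib_right[symmetric] Suc.IH by simp
  finally show ?case .
qed (simp add: wt_def)

text \<open>For odd \<open>q\<close> the numbers \<open>d + q * y\<close> and \<open>d + y\<close>
  have the same parity, so this sign is also multiplicative over the digits; each digit contributes
  the factor 1.\<close>

lemma sum_alternating_wt_parity: 
  assumes "odd q" shows "(\<Sum>h<q ^ m. (-1::int) ^ (h + wt q m h)) = 1"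
proof (induction m)
  case (Suc m)
  obtain r where q: "q = Suc r" using assms by (cases q) auto
  \<comment> \<open>The nonzero digits have signs +1, -1, +1, ..., which cancel because their number
    \<open>r = q - 1\<close> is even.\<close>
  have "(\<Sum>d<q. (-1::int) ^ (d + of_bool (d \<noteq> 0))) = 1 + (\<Sum>d<r. (-1) ^ d)"
    unfolding q lessThan_Suc_eq_insert_0 by (simp add: sum.reindex)
  also have "(\<Sum>d<r. (-1::int) ^ d) = 0"
    using sum_alternating_nat[OF assms] assms unfolding q by simp
  finally have d: "(\<Sum>d<q. (-1::int) ^ (d + of_bool (d \<noteq> 0))) = 1" by simp
  have "(-1::int) ^ (d + q * y + wt q (Suc m) (d + q * y))
      = (-1) ^ (y + wt q m y) * (-1) ^ (d + of_bool (d \<noteq> 0))" if "d < q" for y d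
    using that assms by (simp add: wt_Suc power_add power_mult)
  then have "(\<Sum>h<q ^ Suc m. (-1::int) ^ (h + wt q (Suc m) h))
    = (\<Sum>y<q ^ m. \<Sum>d<q. (-1) ^ (y + wt q m y) * (-1) ^ (d + of_bool (d \<noteq> 0)))"
    unfolding sum_digit_split by (intro sum.cong refl) simp
  also have "\<dots> = 1"
    unfolding sum_distrib_left[symmetric] d sum_distrib_right[symmetric] Suc.IH by simp
  finally show ?case .
qed (simp add: wt_def)

lemma Omega_eq:
  assumes "odd N'" "n = (N' - 1) div 2"
  shows "Omega n = {h. h < N' - 1 \<and> odd h}"
proof (intro equalityI subsetI)
  fix h assume "h \<in> {h. h < N' - 1 \<and> odd h}"
  moreover from this obtain i where "h = 1 + 2 * i" by (auto elim: oddE)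
  ultimately show "h \<in> Omega n" using assms unfolding Omega_def by auto
qed (use assms in \<open>auto simp: Omega_def\<close>)

lemma card_T_set_odd:
  assumes "odd q" "n = (q ^ m - 1) div 2"
  shows "4 * int (card (T_set q m 1 n)) = int q ^ m - (2 - int q) ^ m"
proof -
  let ?w = "\<lambda>h. wt q m h"
  have odd: "odd (q ^ m)" using assms by simp
  \<comment> \<open>Letting \<open>h\<close> run up to \<open>q ^ m - 1\<close> adds nothing, as
    that number is even.\<close>
  have T: "T_set q m 1 n = {h \<in> {..<q ^ m}. odd h \<and> odd (?w h)}"
  proof (intro equalityI subsetI)
    fix h assume "h \<in> {h \<in> {..<q ^ m}. odd h \<and> odd (?w h)}"
    then have "h < q ^ m" "odd h" "odd (?w h)" by auto
    moreover from this have "h \<noteq> q ^ m - 1" using odd by auto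
    ultimately show "h \<in> T_set q m 1 n"
      unfolding T_set_def Omega_eq[OF odd assms(2)] by (auto simp: odd_iff_mod_2_eq_one)
  qed (auto simp: T_set_def Omega_eq[OF odd assms(2)] odd_iff_mod_2_eq_one)
  have "4 * int (card (T_set q m 1 n)) = (\<Sum>h<q ^ m. 4 * of_bool (odd h \<and> odd (?w h)))"
    unfolding T by (simp add: sum_distrib_left[symmetric] Int_def)
  \<comment> \<open>Four times the indicator is the expanded product of \<open>1 - (-1) ^ h\<close>
    and \<open>1 - (-1) ^ wt q m h\<close>.\<close>
  also have "\<dots> = (\<Sum>h<q ^ m. (1 - (-1) ^ h - (-1) ^ ?w h + (-1) ^ (h + ?w h)))"
    by (intro sum.cong refl) (auto simp: power_add minus_one_power_iff)
  also have "\<dots> = int q ^ m - (2 - int q) ^ m"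
    using sum_alternating_nat[OF odd] sum_alternating_wt[OF assms(1), of m]
      sum_alternating_wt_parity[OF assms(1), of m]
    by (simp add: sum.distrib sum_subtractf)
  finally show ?thesis .
qed

lemma append_less: "x < q ^ k \<Longrightarrow> y < q ^ l \<Longrightarrow> x + q ^ k * y < q ^ (k + l)" for q :: nat
proof -
  assume "x < q ^ k" "y < q ^ l"
  then have "x + q ^ k * y < q ^ k * Suc y" by simp
  also have "\<dots> \<le> q ^ k * q ^ l" using \<open>y < q ^ l\<close> by (intro mult_left_mono) auto
  finally show ?thesis by (simp add: power_add)
qed

lemma T_set_eq:
  assumes "odd q" "n = (q ^ m - 1) div 2"
  shows "T_set q m i n = {h. h < q ^ m \<and> odd h \<and> wt q m h mod 2 = i mod 2 \<and> h \<noteq> q ^ m - 1}"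
proof -
  have "odd (q ^ m)" using assms by simp
  moreover have "h < N - 1 \<longleftrightarrow> h < N \<and> h \<noteq> N - 1" for h N :: nat by linarith
  ultimately show ?thesis unfolding T_set_def Omega_eq[OF \<open>odd (q ^ m)\<close> assms(2)] by blast
qed

lemma T_setI:
  assumes "odd q" "n = (q ^ m - 1) div 2" "h < q ^ m" "odd h" "wt q m h mod 2 = i mod 2"
  shows "h \<in> T_set q m i n"
proof -
  have "even (q ^ m - 1)" using assms by simp
  with assms show ?thesis by (auto simp: T_set_eq)
qed

text \<open>Modulo \<open>q ^ m - 1\<close>, multiplication by \<open>q\<close> rotates the digits
  cyclically: the top digit \<open>t\<close> moves to the bottom. The weight is kept, and parity
  survives because \<open>q\<close> is odd and the modulus even. In terms of powers of
  \<open>\<beta>\<close> this is closure of the zeros under Frobenius.\<close>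

lemma T_set_mult_mod:
  assumes q: "odd q" and n: "n = (q ^ m - 1) div 2" and m: "m \<ge> 1" and h: "h \<in> T_set q m i n"
  shows "(q * h) mod (q ^ m - 1) \<in> T_set q m i n"
proof -
  obtain l where l: "m = Suc l" using m by (cases m) auto
  define r where "r = h mod q ^ l"
  define t where "t = h div q ^ l"
  have hlt: "h < q ^ m" and hodd: "odd h" and hwt: "wt q m h mod 2 = i mod 2" and hN: "h \<noteq> q ^ m - 1"
    using h q n by (auto simp: T_set_eq)
  have q0: "q > 0" using q by (cases q) auto
  have hrt: "h = r + q ^ l * t" by (simp add: r_def t_def)
  have r: "r < q ^ l" using q0 by (simp add: r_def)
  have t: "t < q" using hlt unfolding t_def l by (simp add: less_mult_imp_div_less)
  let ?g = "t + q * r"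
  have wt: "wt q m ?g = wt q m h"
    unfolding hrt l using r t by (simp add: wt_Suc wt_Suc_top)
  have lt: "?g < q ^ m" using append_less[of t q 1 r l] r t l by simp
  \<comment> \<open>The value \<open>q ^ m - 1\<close> would reduce to 0. Its digits are all
    \<open>q - 1\<close>, so rotating back would give \<open>h = q ^ m - 1\<close>.\<close>
  have neq: "?g \<noteq> q ^ m - 1"
  proof
    assume "?g = q ^ m - 1"
    then have g: "t + 1 + q * r = q * q ^ l" using q0 l by simp
    have "q dvd q * q ^ l" by simp
    then have "q dvd (t + 1) + q * r" unfolding g .
    then have "q dvd t + 1" using dvd_add_left_iff[of q "q * r" "t + 1"] by simp
    then have "q \<le> t + 1" by (rule dvd_imp_le) simp
    with t have t1: "t + 1 = q" by simp
    with g have "q * (r + 1) = q * q ^ l" by simp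
    then have r1: "r + 1 = q ^ l" unfolding mult_cancel1 using q0 by simp
    have "h + 1 = (r + 1) + q ^ l * t" unfolding hrt by simp
    also have "\<dots> = q ^ l * (t + 1)" unfolding r1 by simp
    also have "\<dots> = q ^ m" unfolding t1 l by simp
    finally have "h + 1 = q ^ m" .
    with hN show False by simp
  qed
  obtain N where N: "q ^ m = Suc N" using q0 by (cases "q ^ m") auto
  have "q * h = q * r + t * q ^ m" unfolding hrt l by (simp add: algebra_simps)
  then have qh: "q * h = ?g + t * (q ^ m - 1)" unfolding N by simp
  then have "(q * h) mod (q ^ m - 1) = ?g mod (q ^ m - 1)" by simp
  also have "\<dots> = ?g" using lt neq by simp
  finally have eq: "(q * h) mod (q ^ m - 1) = ?g" .
  have "even (t * (q ^ m - 1))" using q by simp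
  moreover have "odd (q * h)" using q hodd by simp
  ultimately have "odd ?g" unfolding qh by simp
  with lt wt hwt show ?thesis unfolding eq by (intro T_setI q n) auto
qed

section \<open>Arithmetic progressions inside the defining sets\<close>

lemma T_set_1_progression:
  assumes "odd q" "n = (q ^ (2 * k + 1) - 1) div 2" "odd c" "c < q" "a < q ^ k"
  shows "c * q ^ (2 * k) + (q ^ k + 1) * a \<in> T_set q (2 * k + 1) 1 n"
proof -
  have eq: "c * q ^ (2 * k) + (q ^ k + 1) * a = a + q ^ k * (a + q ^ k * c)"
    by (simp add: algebra_simps power_mult power2_eq_square)
  have m: "2 * k + 1 = k + Suc k" by simp
  have "wt q (2 * k + 1) (a + q ^ k * (a + q ^ k * c)) = 2 * wt q k a + 1"
    unfolding m using assms by (subst wt_append) (auto simp: wt_Suc_top intro: Nat.gr0I)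
  moreover have "a + q ^ k * (a + q ^ k * c) < q ^ (2 * k + 1)"
    unfolding m using append_less[of a q k c 1] assms by (intro append_less) auto
  \<comment> \<open>The step \<open>q ^ k + 1\<close> is even, so \<open>c * q ^ (2 * k)\<close>
    alone decides the parity.\<close>
  moreover have "odd (c * q ^ (2 * k) + (q ^ k + 1) * a)" using assms by simp
  ultimately show ?thesis using assms(1,2) unfolding eq by (intro T_setI) auto
qed

text \<open>Subtracting \<open>(q ^ k + 1) * b\<close> from \<open>3 * q ^ (2 * k)\<close> borrows:
  the top digit becomes 2, the middle block q^k - b - 1 and the low block q^k - b. The two blocks
  differ only in their lowest digit, which is nonzero in both by \<open>b + 2 \<le> q\<close>, so
  their weights agree.\<close>

lemma T_set_1_progression_left:
  assumes "odd q" "n = (q ^ (2 * k + 1) - 1) div 2" "k \<ge> 1" "b \<ge> 1" "b + 2 \<le> q" "q > 2"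
    and h: "h + (q ^ k + 1) * b = 3 * q ^ (2 * k)"
  shows "h \<in> T_set q (2 * k + 1) 1 n"
proof -
  obtain l where k: "k = Suc l" using assms by (cases k) auto
  obtain p where p: "q ^ l = Suc p" using assms by (metis not0_implies_Suc power_not_zero not_numeral_less_zero)
  define y where "y = (q - b - 1) + q * p"
  have y: "Suc y = (q - b) + q * p" using assms by (simp add: y_def)
  have yb: "y + b + 1 = q ^ k" using assms p by (simp add: y_def k)
  \<comment> \<open>Substituting \<open>y + b + 1\<close> for \<open>q ^ k\<close> solves for
    \<open>h\<close> without truncated subtraction.\<close>
  have "q ^ (2 * k) = q ^ k * q ^ k" by (simp add: mult_2 power_add)
  then have "3 * q ^ (2 * k) = 3 * ((y + b + 1) * (y + b + 1))" by (simp only: yb)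
  then have heq: "h = Suc y + q ^ k * (y + q ^ k * 2)"
    using h unfolding yb[symmetric] by (simp add: algebra_simps)
  have wt1: "wt q k (Suc y) = wt q k y"
  proof -
    have "wt q k (Suc y) = 1 + wt q l p" unfolding y k using assms by (subst wt_Suc) auto
    moreover have "wt q k y = 1 + wt q l p" unfolding y_def k using assms by (subst wt_Suc) auto
    ultimately show ?thesis by simp
  qed
  have lt: "Suc y < q ^ k" "y < q ^ k" using yb assms by auto
  have m: "2 * k + 1 = k + Suc k" by simp
  have "wt q (2 * k + 1) h = 2 * wt q k y + 1"
    unfolding m heq wt_append[OF lt(1)] wt_Suc_top[OF lt(2) \<open>q > 2\<close>] wt1 by simp
  moreover have "h < q ^ (2 * k + 1)"
    unfolding m heq using append_less[of y q k 2 1] assms lt by (intro append_less) auto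
  moreover have "odd (h + (q ^ k + 1) * b)" unfolding h using assms by simp
  then have "odd h" using assms by simp
  ultimately show ?thesis using assms(1,2) by (intro T_setI) auto
qed

text \<open>With \<open>a = r + q ^ l * t\<close>, the term \<open>q ^ (2 * l + 1)\<close> is one
  unit in the leading digit of the upper copy of \<open>a\<close>. The lower copy keeps
  \<open>t\<close>, the upper one gets \<open>t + 1\<close>, and both count once.\<close>

lemma T_set_0_progression:
  assumes "odd q" "n = (q ^ (2 * l + 3) - 1) div 2" "q > 1" "q ^ l \<le> a" "a < q ^ Suc l"
  shows "q ^ (2 * l + 1) + (q ^ Suc l + 1) * a \<in> T_set q (2 * l + 3) 0 n"
proof -
  define r where "r = a mod q ^ l"
  define t where "t = a div q ^ l"
  have art: "a = r + q ^ l * t" by (simp add: r_def t_def)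
  have r: "r < q ^ l" using assms by (simp add: r_def)
  have t: "t < q" using assms unfolding t_def by (simp add: less_mult_imp_div_less)
  have t1: "t \<ge> 1" using assms unfolding t_def by (simp add: Suc_leI div_greater_zero_iff)
  let ?h = "q ^ (2 * l + 1) + (q ^ Suc l + 1) * a"
  have eq: "?h = r + q ^ l * (t + q * (r + q ^ l * (t + 1)))"
  proof -
    have "q ^ (2 * l + 1) = q * (q ^ l * q ^ l)" by (simp add: mult_2 power_add)
    then show ?thesis unfolding art by (simp add: algebra_simps)
  qed
  \<comment> \<open>If \<open>t + 1 = q\<close>, the carry leaves the digit 0 with a 1 above it,
    again of weight one.\<close>
  have top: "wt q 2 (t + 1) = 1"
  proof (cases "t + 1 < q")
    case True
    then have "wt q (Suc 1) ((t + 1) + q * 0) = 1"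
      using assms by (subst wt_Suc) (auto simp: wt_digit)
    then show ?thesis by (simp add: numeral_2_eq_2)
  next
    case False
    then have "t + 1 = 0 + q * 1" using t by simp
    then have "wt q (Suc 1) (t + 1) = 1"
      using assms by (simp only:, subst wt_Suc) (auto simp: wt_digit)
    then show ?thesis by (simp add: numeral_2_eq_2)
  qed
  have m: "2 * l + 3 = l + Suc (l + 2)" by simp
  have "wt q (2 * l + 3) ?h = 2 * wt q l r + 2"
    unfolding eq m wt_append[OF r] wt_Suc[OF t] top using t1 by simp
  moreover have "?h < q ^ (2 * l + 3)"
  proof -
    have "t + 1 \<le> q" using t by simp
    also have "q < q ^ 2" using assms by (simp add: power2_eq_square)
    finally have "t + 1 < q ^ 2" .
    with r have *: "r + q ^ l * (t + 1) < q ^ (l + 2)" by (rule append_less)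
    have "t < q ^ 1" using t by simp
    from append_less[OF this *] have "t + q * (r + q ^ l * (t + 1)) < q ^ Suc (l + 2)" by simp
    from append_less[OF r this] show ?thesis unfolding eq m .
  qed
  moreover have "odd ?h" using assms by simp
  ultimately show ?thesis using assms(1,2) by (intro T_setI) auto
qed

text \<open>Hence \<open>\<beta>\<^sup>2\<close> is a power of \<open>\<beta>\<close> to the \<open>q\<^sup>k + 1\<close>, whose powers up to \<open>n\<close> are therefore
  distinct. The witnesses come from \<open>q q\<^sup>k q\<^sup>k \<equiv> 1\<close> and \<open>M = (q\<^sup>k - 1) / (q - 1)\<close>.\<close>

lemma ex_multiple_eq_2_mod:
  fixes q k :: nat
  assumes "q > 0"
  shows "\<exists>A B. (q ^ k + 1) * A = 2 + B * (q ^ (2 * k + 1) - 1)"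
proof -
  obtain r where r: "q = Suc r" using assms by (cases q) auto
  have "\<exists>M. q ^ k = r * M + 1"
  proof (induction k)
    case (Suc k)
    then obtain M where "q ^ k = r * M + 1" by blast
    then have "q ^ Suc k = r * (q * M + 1) + 1" by (simp add: r algebra_simps)
    then show ?case by blast
  qed (auto intro: exI[of _ 0])
  then obtain M where M: "q ^ k = r * M + 1" by blast
  obtain N where N: "q ^ (2 * k + 1) = Suc N" using assms by (metis not0_implies_Suc power_not_zero neq0_conv)
  have "q ^ (2 * k + 1) = q * q ^ k * q ^ k" by (simp add: mult_2 power_add)
  then have "Suc N = (r + 1) * (r * M + 1) * (r * M + 1)" unfolding N M by (simp add: r)
  then have N': "Suc N * M = (r + 1) * (r * M + 1) * (r * M + 1) * M" by simp
  \<comment> \<open>With \<open>M\<close> added to both sides, \<open>q ^ m\<close> replaces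
    \<open>q ^ m - 1\<close>, and the claim becomes a polynomial identity in \<open>r\<close> and
    \<open>M\<close>.\<close>
  have "(q ^ k + 1) * (q * r * M * M + 1) + M = (r * M + 1 + 1) * ((r + 1) * r * M * M + 1) + M"
    unfolding M by (simp add: r)
  also have "\<dots> = 2 + Suc N * M" unfolding N' by (simp add: algebra_simps)
  finally have "(q ^ k + 1) * (q * r * M * M + 1) + M = 2 + Suc N * M" .
  then have "(q ^ k + 1) * (q * r * M * M + 1) = 2 + M * (q ^ (2 * k + 1) - 1)"
    unfolding N by simp
  then show ?thesis by blast
qed

subsection \<open>Polynomials modulo \<open>x\<^sup>n + 1\<close>\<close>

lemma coeff_codeword_poly: "coeff (codeword_poly n c) j = (if j < n then c $ j else 0)"
  by (simp add: codeword_poly_def coeff_sum)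

lemma degree_codeword_poly: "n > 0 \<Longrightarrow> degree (codeword_poly n c) < n"
  by (rule le_less_trans[OF degree_le[of "n - 1"]]) (auto simp: coeff_codeword_poly)

lemma codeword_poly_vec_coeff: "\<forall>j\<ge>n. coeff f j = 0 \<Longrightarrow> codeword_poly n (vec n (coeff f)) = f"
  by (rule poly_eqI) (simp add: coeff_codeword_poly)

lemma genideal_class_ring: "genideal class_ring {p} = {r * p | r. True}" for p :: "'a::comm_ring_1"
  using cring.cgenideal_eq_genideal[OF class_cring.cring_axioms, of p] by (auto simp: cgenideal_def)

lemma coset_genideal_eq_iff:
  fixes p f f' :: "'a::comm_ring_1"
  defines "I \<equiv> genideal class_ring {p}"
  shows "I +>\<^bsub>class_ring\<^esub> f = I +>\<^bsub>class_ring\<^esub> f' \<longleftrightarrow> (\<exists>s. f = f' + s * p)"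
proof -
  let ?c = "\<lambda>f. I +>\<^bsub>class_ring\<^esub> f"
  have coset: "?c f = {s * p + f | s. True}" for f
    by (auto simp: a_r_coset_def r_coset_def I_def genideal_class_ring)
  show ?thesis
  proof
    assume "?c f = ?c f'"
    moreover have "f \<in> ?c f" unfolding coset by (auto intro: exI[of _ 0])
    ultimately show "\<exists>s. f = f' + s * p" unfolding coset by (auto simp: add.commute)
  next
    assume "\<exists>s. f = f' + s * p"
    then obtain s where s: "f = f' + s * p" by blast
    have "t * p + f = (t + s) * p + f'" "t * p + f' = (t - s) * p + f" for t
      by (simp_all add: s algebra_simps)
    then show "?c f = ?c f'" unfolding coset by blast
  qed
qed

text \<open>A principal ideal of the quotient pulls back to the ideal generated by \<open>g\<close>
  and \<open>p\<close>. This turns membership of cosets into polynomial identities.\<close>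

lemma mem_genideal_Quot:
  fixes p f g :: "'a::comm_ring_1"
  defines "I \<equiv> genideal class_ring {p}"
  shows "I +>\<^bsub>class_ring\<^esub> f \<in> genideal (class_ring Quot I) {I +>\<^bsub>class_ring\<^esub> g}
    \<longleftrightarrow> (\<exists>r s. f = r * g + s * p)"
proof -
  interpret I: ideal I class_ring
    unfolding I_def by (rule ring.genideal_ideal[OF class_ring.ring_axioms]) simp
  interpret Q: cring "class_ring Quot I"
    by (rule I.quotient_is_cring) (rule class_cring.cring_axioms)
  let ?c = "\<lambda>f. I +>\<^bsub>class_ring\<^esub> f"
  have carrier: "carrier (class_ring Quot I) = range ?c"
    by (auto simp: FactRing_def A_RCOSETS_def RCOSETS_def a_r_coset_def)
  have mult: "?c r \<otimes>\<^bsub>class_ring Quot I\<^esub> ?c g = ?c (r * g)" for r g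
    using I.rcoset_mult_add[of r g] by (simp add: FactRing_def)
  have "genideal (class_ring Quot I) {?c g} = {?c (r * g) | r. True}"
  proof (subst Q.cgenideal_eq_genideal[symmetric])
    show "?c g \<in> carrier (class_ring Quot I)" by (simp add: carrier)
    have "PIdl\<^bsub>class_ring Quot I\<^esub> ?c g = {?c r \<otimes>\<^bsub>class_ring Quot I\<^esub> ?c g | r. True}"
      unfolding cgenideal_def carrier by blast
    then show "PIdl\<^bsub>class_ring Quot I\<^esub> ?c g = {?c (r * g) | r. True}" by (simp add: mult)
  qed
  then show ?thesis by (auto simp: coset_genideal_eq_iff I_def)
qed

lemma code_generated_by_iff:
  "c \<in> code_generated_by n g \<longleftrightarrow>
    c \<in> carrier_vec n \<and> (\<exists>r s. codeword_poly n c = r * g + s * (monom 1 n + 1))"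
  by (simp add: code_generated_by_def residue_class_def negacyclic_ring_def negacyclic_ideal_def
      mem_genideal_Quot)

text \<open>Every coset contains its remainder modulo x^n + 1, which is the polynomial of a vector
  of length \<open>n\<close>; hence the image of the code is the full principal ideal.\<close>

lemma ideal_code_generated_by:
  fixes g :: "'a::field poly"
  assumes "n > 0"
  shows "ideal ((\<lambda>c. residue_class n (codeword_poly n c)) ` code_generated_by n g) (negacyclic_ring n)"
proof -
  let ?p = "monom 1 n + 1 :: 'a poly"
  interpret I: ideal "negacyclic_ideal n :: 'a poly set" class_ring
    unfolding negacyclic_ideal_def by (rule ring.genideal_ideal[OF class_ring.ring_axioms]) simp
  interpret Q: cring "negacyclic_ring n :: 'a poly set ring"
    unfolding negacyclic_ring_def by (rule I.quotient_is_cring) (rule class_cring.cring_axioms)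
  have carrier: "carrier (negacyclic_ring n) = range (residue_class n :: 'a poly \<Rightarrow> _)"
    by (auto simp: negacyclic_ring_def residue_class_def FactRing_def A_RCOSETS_def RCOSETS_def a_r_coset_def)
  have ideal: "ideal (genideal (negacyclic_ring n) {residue_class n g}) (negacyclic_ring n)"
    by (rule Q.genideal_ideal) (simp add: carrier)
  have deg: "degree ?p = n" using assms
    by (subst degree_add_eq_left) (auto simp: degree_monom_eq)
  have "X \<in> (\<lambda>c. residue_class n (codeword_poly n c)) ` code_generated_by n g"
    if X: "X \<in> genideal (negacyclic_ring n) {residue_class n g}" for X
  proof -
    have "X \<in> carrier (negacyclic_ring n)"
      using X ideal ideal.Icarr by metis
    then obtain f where f: "X = residue_class n f" using carrier by blast
    let ?r = "f mod ?p" 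
    have "?p \<noteq> 0" using deg assms by auto
    then have "degree ?r < n" using degree_mod_less'[of ?p f] deg assms by (cases "?r = 0") auto
    then have r: "codeword_poly n (vec n (coeff ?r)) = ?r"
      by (intro codeword_poly_vec_coeff) (auto simp: coeff_eq_0)
    have "?r = f + - (f div ?p) * ?p"
      using div_mult_mod_eq[of f ?p] by (simp add: algebra_simps)
    then have "residue_class n ?r = X"
      unfolding f residue_class_def negacyclic_ideal_def coset_genideal_eq_iff by blast
    then show ?thesis using r X
      by (intro image_eqI[of _ _ "vec n (coeff ?r)"]) (auto simp: code_generated_by_def)
  qed
  then have "(\<lambda>c. residue_class n (codeword_poly n c)) ` code_generated_by n g
      = genideal (negacyclic_ring n) {residue_class n g}"
    by (auto simp: code_generated_by_def)
  with ideal show ?thesis by simp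
qed

subsection \<open>Codes given by their zeros\<close>

lemma prod_linear_dvd_iff:
  fixes p :: "'a::field poly"
  assumes "finite S"
  shows "(\<Prod>x\<in>S. [:- x, 1:]) dvd p \<longleftrightarrow> (\<forall>x\<in>S. poly p x = 0)"
proof
  assume dvd: "(\<Prod>x\<in>S. [:- x, 1:]) dvd p"
  show "\<forall>x\<in>S. poly p x = 0"
  proof
    fix x assume "x \<in> S"
    with assms have "[:- x, 1:] dvd (\<Prod>x\<in>S. [:- x, 1:])" by (rule dvd_prodI)
    then show "poly p x = 0" using dvd by (simp add: poly_eq_0_iff_dvd dvd_trans)
  qed
next
  assume "\<forall>x\<in>S. poly p x = 0"
  with assms show "(\<Prod>x\<in>S. [:- x, 1:]) dvd p"
  proof (induction S arbitrary: p rule: finite_induct)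
    case (insert a S)
    then have "(\<Prod>x\<in>S. [:- x, 1:]) dvd p" by simp
    then obtain r where r: "p = (\<Prod>x\<in>S. [:- x, 1:]) * r" by (elim dvdE)
    have "poly (\<Prod>x\<in>S. [:- x, 1:]) a \<noteq> 0"
      using insert.hyps by (auto simp: poly_prod)
    then have "poly r a = 0" using insert.prems r by auto
    then have "[:- a, 1:] dvd r" by (simp add: poly_eq_0_iff_dvd)
    then have "[:- a, 1:] * (\<Prod>x\<in>S. [:- x, 1:]) dvd r * (\<Prod>x\<in>S. [:- x, 1:])"
      by (rule mult_dvd_mono) simp
    then show ?case unfolding r prod.insert[OF insert.hyps] by (simp only: mult.commute)
  qed simp
qed

lemma degree_prod_linear: "degree (\<Prod>x\<in>S. [:- x, 1:]) = card S" for S :: "'a::field set"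
  by (cases "finite S") (simp_all add: degree_prod_eq_sum_degree)

section \<open>Finite fields and descent of polynomials along Frobenius\<close>

lemma of_nat_card_eq_0: "of_nat CARD('a) = (0 :: 'a::{field,finite})"
proof -
  \<comment> \<open>Translation by 1 permutes the field, so the added ones must sum to zero.\<close>
  have "(\<Sum>x\<in>UNIV. x + 1 :: 'a) = \<Sum>UNIV"
    by (rule sum.reindex_bij_witness[of _ "\<lambda>x. x - 1" "\<lambda>x. x + 1"]) auto
  then show ?thesis by (simp add: sum.distrib)
qed

lemma CHAR_eq_prime_of_card:
  assumes "prime p" "CARD('a::{field,finite}) = p ^ k"
  shows "CHAR('a) = p"
proof -
  have "(of_nat p :: 'a) ^ k = of_nat CARD('a)" using assms by simp
  also have "\<dots> = 0" by (rule of_nat_card_eq_0)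
  finally have "(of_nat p :: 'a) = 0" by simp
  then have "CHAR('a) dvd p" by (simp add: of_nat_eq_0_iff_char_dvd)
  then show ?thesis using assms(1) CHAR_not_1'[where 'a='a] by (auto simp: prime_nat_iff)
qed

text \<open>Multiplication by a nonzero \<open>x\<close> permutes the nonzero elements; compare
  their products.\<close>

lemma finite_field_pow_card: "x ^ CARD('a) = x" for x :: "'a::{field,finite}"
proof (cases "x = 0")
  case False
  have "(\<Prod>y\<in>UNIV-{0}. x * y) = (\<Prod>y\<in>UNIV-{0}. y)"
    by (rule prod.reindex_bij_witness[of _ "\<lambda>y. y / x" "\<lambda>y. x * y"]) (use False in auto)
  then have "x ^ (CARD('a) - 1) * \<Prod>(UNIV - {0::'a}) = \<Prod>(UNIV - {0})"
    by (simp add: prod.distrib)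
  then have "x ^ (CARD('a) - 1) = 1" by simp
  then show ?thesis by (metis Suc_diff_1 mult.right_neutral power_Suc zero_less_card_finite)
qed (simp add: zero_power)

text \<open>The two cardinalities are powers of the same prime, which makes the power map with
  exponent \<open>CARD('a)\<close> additive on the larger field.\<close>

locale finite_field_extension = field_hom \<phi>
  for \<phi> :: "'a::{field,finite} \<Rightarrow> 'b::{field,finite}" +
  assumes card_prime_power: "\<exists>p k. prime p \<and> CARD('a) = p ^ k"
    and card_power: "\<exists>m. CARD('b) = CARD('a) ^ m"
begin

lemma frobenius_add: "(x + y) ^ CARD('a) = x ^ CARD('a) + y ^ CARD('a)" for x y :: 'b
proof -
  obtain p k m where p: "prime p" "CARD('a) = p ^ k" "CARD('b) = p ^ (k * m)"
    using card_prime_power card_power by (metis power_mult)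
  then have "CHAR('b) = p" by (intro CHAR_eq_prime_of_card)
  with p show ?thesis by (intro freshmans_dream'[of _ k]) auto
qed

text \<open>X^q - X has at most q roots, and the image of the base field already supplies q of
  them.\<close>

lemma frobenius_fixed: "x ^ CARD('a) = x \<longleftrightarrow> x \<in> range \<phi>"
proof -
  let ?q = "CARD('a)"
  define p :: "'b poly" where "p = monom 1 ?q - monom 1 1"
  have q: "?q > 1" using card_mono[of UNIV "{0, 1 :: 'a}"] by simp
  have "coeff p ?q = 1" using q by (simp add: p_def)
  then have p0: "p \<noteq> 0" by auto
  have "degree p \<le> ?q" unfolding p_def using q by (intro degree_diff_le) (auto simp: degree_monom_eq)
  then have "card {x. poly p x = 0} \<le> ?q" using card_poly_roots_bound[OF p0] by simp
  moreover have "range \<phi> \<subseteq> {x. poly p x = 0}"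
    by (auto simp: p_def poly_monom finite_field_pow_card simp flip: hom_power)
  moreover have "card (range \<phi>) = ?q" by (rule card_image) (rule inj_f)
  ultimately have "range \<phi> = {x. poly p x = 0}"
    by (intro card_seteq) (auto simp: p0 poly_roots_finite)
  then show ?thesis by (auto simp: p_def poly_monom)
qed

text \<open>The Frobenius map permutes \<open>S\<close>, so it fixes the coefficients of the product.\<close>

lemma ex_map_poly_eq_prod_linear:
  assumes "\<And>x. x \<in> S \<Longrightarrow> x ^ CARD('a) \<in> S"
  shows "\<exists>g. map_poly \<phi> g = (\<Prod>x\<in>S. [:- x, 1:])"
proof -
  let ?F = "\<lambda>x :: 'b. x ^ CARD('a)"
  have q0: "CARD('a) \<noteq> 0" by simp
  interpret F: field_hom ?F
    by unfold_locales (simp_all add: frobenius_add power_mult_distrib zero_power)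
  interpret FP: map_poly_idom_hom ?F ..
  have "?F ` S = S"
    by (rule endo_inj_surj) (use assms F.inj_f in \<open>auto intro: inj_on_subset\<close>)
  then have "(\<Prod>x\<in>S. [:- x, 1:]) = (\<Prod>x\<in>?F ` S. [:- x, 1:])" by simp
  also have "\<dots> = (\<Prod>x\<in>S. [:- ?F x, 1:])"
    by (subst prod.reindex) (auto intro: inj_on_subset[OF F.inj_f])
  also have "\<dots> = map_poly ?F (\<Prod>x\<in>S. [:- x, 1:])"
    by (simp add: hom_distribs F.hom_uminus)
  finally have F: "coeff (\<Prod>x\<in>S. [:- x, 1:]) i = ?F (coeff (\<Prod>x\<in>S. [:- x, 1:]) i)" for i
    by (metis F.coeff_map_poly_hom)
  define g where "g = map_poly (the_inv \<phi>) (\<Prod>x\<in>S. [:- x, 1:])"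
  have "map_poly \<phi> g = (\<Prod>x\<in>S. [:- x, 1:])"
  proof (rule poly_eqI)
    fix i
    \<comment> \<open>Preserving 0 is what lets \<open>map_poly\<close> act coefficientwise.\<close>
    have "the_inv \<phi> 0 = 0" by (metis hom_zero inj_f the_inv_f_f)
    moreover have "coeff (\<Prod>x\<in>S. [:- x, 1:]) i \<in> range \<phi>"
      using F[of i] frobenius_fixed by metis
    ultimately show "coeff (map_poly \<phi> g) i = coeff (\<Prod>x\<in>S. [:- x, 1:]) i"
      by (simp add: g_def coeff_map_poly f_the_inv_into_f[OF inj_f])
  qed
  then show ?thesis ..
qed

end

text \<open>Evaluation at the zeros avoids choosing a generator polynomial and suits both the BCH
  argument and the dual code.\<close>

definition zero_code :: "('a::field \<Rightarrow> 'b::field) \<Rightarrow> nat \<Rightarrow> 'b set \<Rightarrow> 'a vec set" where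
  "zero_code \<phi> n S = {c \<in> carrier_vec n. \<forall>x\<in>S. (\<Sum>j<n. \<phi> (c $ j) * x ^ j) = 0}"

context field_hom
begin

lemma poly_map_codeword_poly:
  "poly (map_poly hom (codeword_poly n c)) x = (\<Sum>j<n. hom (c $ j) * x ^ j)"
proof -
  interpret MP: map_poly_idom_hom hom ..
  show ?thesis by (simp add: codeword_poly_def hom_distribs poly_sum poly_monom)
qed

text \<open>Divisibility can be tested over the extension field, where \<open>g\<close> splits into
  distinct linear factors.\<close>

lemma mem_zero_code_iff_dvd:
  assumes "finite S" "map_poly hom g = (\<Prod>x\<in>S. [:- x, 1:])"
  shows "c \<in> zero_code hom n S \<longleftrightarrow> c \<in> carrier_vec n \<and> g dvd codeword_poly n c"
proof -
  interpret MP: map_poly_idom_hom hom ..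
  have "g dvd codeword_poly n c \<longleftrightarrow> map_poly hom g dvd map_poly hom (codeword_poly n c)"
    using dvd_map_poly_hom_imp_dvd MP.hom_dvd by blast
  then show ?thesis using assms
    by (simp add: zero_code_def prod_linear_dvd_iff poly_map_codeword_poly)
qed

text \<open>All of \<open>S\<close> being roots of x^n + 1, \<open>g\<close> divides x^n + 1, so the
  ideal generated by both is that of \<open>g\<close>.\<close>

lemma code_generated_by_eq_zero_code:
  assumes "finite S" "\<And>x. x \<in> S \<Longrightarrow> x ^ n = - 1" "map_poly hom g = (\<Prod>x\<in>S. [:- x, 1:])"
  shows "code_generated_by n g = zero_code hom n S"
proof -
  interpret MP: map_poly_idom_hom hom ..
  have "map_poly hom g dvd map_poly hom (monom 1 n + 1)"
    using assms by (simp add: prod_linear_dvd_iff hom_distribs poly_monom)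
  then have "g dvd monom 1 n + 1" by (rule dvd_map_poly_hom_imp_dvd)
  then have "g dvd r * g + s * (monom 1 n + 1)" for r s by simp
  moreover have "\<exists>r s. f = r * g + s * (monom 1 n + 1)" if "g dvd f" for f
  proof -
    from that obtain r where "f = g * r" by (elim dvdE)
    then have "f = r * g + 0 * (monom 1 n + 1)" by simp
    then show ?thesis by blast
  qed
  ultimately have "(\<exists>r s. f = r * g + s * (monom 1 n + 1)) \<longleftrightarrow> g dvd f" for f
    by blast
  then show ?thesis
    using assms by (auto simp: code_generated_by_iff mem_zero_code_iff_dvd)
qed

lemma subspace_zero_code: "linear_code n (zero_code hom n S)"
  unfolding linear_code_def
proof (intro subspace.intro submodule.intro vec_vs vec_module)
qed (auto simp: module_vec_simps zero_code_def hom_distribs sum.distrib distrib_right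
      mult.assoc simp flip: sum_distrib_left)

text \<open>Multiplication by \<open>g\<close> is a linear isomorphism from the vectors of length
  \<open>n - card S\<close> onto the code.\<close>

lemma code_dim_zero_code:
  assumes "finite S" "card S \<le> n" "map_poly hom g = (\<Prod>x\<in>S. [:- x, 1:])"
  shows "code_dim n (zero_code hom n S) = n - card S"
proof -
  let ?k = "n - card S"
  let ?V = "module_vec TYPE('a) ?k" and ?W = "(module_vec TYPE('a) n)\<lparr>carrier := zero_code hom n S\<rparr>"
  let ?T = "\<lambda>c. vec n (coeff (g * codeword_poly ?k c))"
  interpret W0: vectorspace class_ring "module_vec TYPE('a) n" by (rule vec_vs)
  interpret W: vectorspace class_ring ?W
    using subspace_zero_code[unfolded linear_code_def] by (rule W0.subspace_is_vs)
  interpret V: vec_space "TYPE('a)" ?k .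
  have deg: "degree g = card S" using assms(3) degree_map_poly_hom[of g] degree_prod_linear by metis
  have g0: "g \<noteq> 0" using assms(1,3) by auto
  have poly_T: "codeword_poly n (?T c) = g * codeword_poly ?k c" for c
  proof (intro codeword_poly_vec_coeff allI impI)
    fix j assume "j \<ge> n"
    show "coeff (g * codeword_poly ?k c) j = 0"
    \<comment> \<open>For length 0 the zero polynomial has degree 0, so the strict degree bound
      needs \<open>?k > 0\<close>.\<close>
    proof (cases "?k = 0")
      case False
      then have "degree (g * codeword_poly ?k c) < n"
        using degree_mult_le[of g "codeword_poly ?k c"] degree_codeword_poly[of ?k c] deg by simp
      then show ?thesis using \<open>j \<ge> n\<close> by (intro coeff_eq_0) simp
    qed (simp add: codeword_poly_def)
  qed
  have add: "codeword_poly ?k (c + d) = codeword_poly ?k c + codeword_poly ?k d"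
    if "c \<in> carrier_vec ?k" "d \<in> carrier_vec ?k" for c d
    using that by (intro poly_eqI) (simp add: coeff_codeword_poly)
  have smult: "codeword_poly ?k (a \<cdot>\<^sub>v c) = Polynomial.smult a (codeword_poly ?k c)"
    if "c \<in> carrier_vec ?k" for a c
    using that by (intro poly_eqI) (simp add: coeff_codeword_poly)
  have inj: "c = d" if "c \<in> carrier_vec l" "d \<in> carrier_vec l" "codeword_poly l c = codeword_poly l d" for c d :: "'a vec" and l
  proof (rule eq_vecI)
    fix j assume "j < dim_vec d"
    then show "c $ j = d $ j" using that coeff_codeword_poly[of l _ j] by (metis carrier_vecD)
  qed (use that in auto)
  interpret T: linear_map class_ring ?V ?W ?T
  proof (intro linear_map.intro mod_hom.intro mod_hom_axioms.intro V.vectorspace_axioms W.vectorspace_axioms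
       V.module_axioms W.module_axioms)
    show "?T \<in> LinearCombinations.module_hom class_ring ?V ?W"
      using assms poly_T
      by (auto simp: LinearCombinations.module_hom_def module_vec_simps mem_zero_code_iff_dvd
          add smult distrib_left intro!: eq_vecI)
  qed
  have "V.dim = W.dim"
  proof (rule T.dim_eq)
    show "V.fin_dim" by simp
    show "inj_on ?T (carrier ?V)"
    proof (rule inj_onI)
      fix c d assume cd: "c \<in> carrier ?V" "d \<in> carrier ?V" and eq: "?T c = ?T d"
      from eq have "codeword_poly n (?T c) = codeword_poly n (?T d)" by (rule arg_cong)
      then have "g * codeword_poly ?k c = g * codeword_poly ?k d" by (simp only: poly_T)
      with g0 have "codeword_poly ?k c = codeword_poly ?k d" by simp
      with cd show "c = d" by (intro inj[of _ ?k]) (simp_all add: module_vec_simps)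
    qed
    show "?T ` carrier ?V = carrier ?W"
    proof (intro equalityI subsetI)
      fix c assume "c \<in> carrier ?W"
      then have c: "c \<in> carrier_vec n" "g dvd codeword_poly n c"
        using assms by (auto simp: mem_zero_code_iff_dvd)
      then obtain f where f: "codeword_poly n c = g * f" by (elim dvdE)
      \<comment> \<open>A nonzero coefficient of the cofactor at \<open>?k\<close> or beyond would
        push the degree of \<open>g * f\<close> to at least \<open>n\<close>.\<close>
      have "coeff f j = 0" if "j \<ge> ?k" for j
      proof (rule ccontr)
        assume nz: "coeff f j \<noteq> 0"
        then have "j \<le> degree f" "f \<noteq> 0" by (auto intro: le_degree)
        then have "degree (g * f) \<ge> n" using that deg g0 by (simp add: degree_mult_eq)
        moreover have "g * f \<noteq> 0" using g0 \<open>f \<noteq> 0\<close> by simp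
        ultimately show False using f coeff_codeword_poly[of n c "degree (g * f)"] by simp
      qed
      then have "codeword_poly ?k (vec ?k (coeff f)) = f"
        by (intro codeword_poly_vec_coeff) auto
      with poly_T[of "vec ?k (coeff f)"] have "codeword_poly n (?T (vec ?k (coeff f))) = codeword_poly n c"
        by (simp only: f)
      then have "?T (vec ?k (coeff f)) = c" using c(1) by (intro inj[of _ n]) auto
      then show "c \<in> ?T ` carrier ?V" by (auto simp: module_vec_simps intro!: image_eqI[of _ _ "vec ?k (coeff f)"])
    qed (use T.f_im in auto)
  qed
  then show ?thesis by (simp add: code_dim_def V.dim_is_n)
qed

end

subsection \<open>Minimum distance and duality\<close>

context field_hom
begin

lemma zero_code_diff:
  "c \<in> zero_code hom n S \<Longrightarrow> d \<in> zero_code hom n S \<Longrightarrow> c - d \<in> zero_code hom n S"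
  by (auto simp: zero_code_def hom_distribs left_diff_distrib sum_subtractf)

text \<open>The zeros make the functional \<open>p \<mapsto> \<Sum>j. c\<^sub>j y\<^sup>j p(z\<^sup>j)\<close> vanish on all polynomials of degree
  less than \<open>\<delta>\<close>. If the support were small, a polynomial vanishing at all but one of the points
  \<open>z\<^sup>j\<close> in the support would isolate a single nonzero coordinate.\<close>

lemma BCH_bound:
  assumes c: "c \<in> zero_code hom n S" "c \<noteq> 0\<^sub>v n"
    and zeros: "\<And>a. a < \<delta> \<Longrightarrow> y * z ^ a \<in> S" and y: "y \<noteq> 0" and inj: "inj_on (\<lambda>j. z ^ j) {..<n}"
  shows "\<delta> < card {j. j < n \<and> c $ j \<noteq> 0}"
proof (rule ccontr)
  let ?A = "{j. j < n \<and> c $ j \<noteq> 0}"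
  assume "\<not> \<delta> < card ?A"
  then have small: "card ?A \<le> \<delta>" by simp
  have cv: "c \<in> carrier_vec n" using c by (simp add: zero_code_def)
  have "?A \<noteq> {}"
  proof
    assume "?A = {}"
    then have "c = 0\<^sub>v n" using cv by (intro eq_vecI) auto
    with c show False by simp
  qed
  then obtain k where k: "k < n" "c $ k \<noteq> 0" by blast
  have moment: "(\<Sum>j<n. hom (c $ j) * y ^ j * (z ^ j) ^ a) = 0" if "a < \<delta>" for a
  proof -
    have "(\<Sum>j<n. hom (c $ j) * (y * z ^ a) ^ j) = 0"
      using c(1) zeros[OF that] by (auto simp: zero_code_def)
    then show ?thesis
      by (simp add: power_mult_distrib ac_simps flip: power_mult)
  qed
  have functional: "(\<Sum>j<n. hom (c $ j) * y ^ j * poly p (z ^ j)) = 0" if "degree p < \<delta>" for p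
  proof -
    have "(\<Sum>j<n. hom (c $ j) * y ^ j * poly p (z ^ j))
      = (\<Sum>a\<le>degree p. coeff p a * (\<Sum>j<n. hom (c $ j) * y ^ j * (z ^ j) ^ a))"
      unfolding poly_altdef sum_distrib_left by (subst sum.swap) (simp add: ac_simps)
    also have "\<dots> = 0" using that moment by (intro sum.neutral) auto
    finally show ?thesis .
  qed
  define p where "p = (\<Prod>x\<in>(\<lambda>j. z ^ j) ` (?A - {k}). [:- x, 1:])"
  have "degree p = card (?A - {k})"
    unfolding p_def degree_prod_linear by (rule card_image) (use inj in \<open>auto simp: inj_on_def\<close>)
  also have "\<dots> < card ?A" using k by (intro psubset_card_mono) auto
  finally have "(\<Sum>j<n. hom (c $ j) * y ^ j * poly p (z ^ j)) = 0"
    using small by (intro functional) simp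
  moreover have "hom (c $ j) * y ^ j * poly p (z ^ j) = 0" if "j < n" "j \<noteq> k" for j
    using that by (cases "c $ j = 0") (auto simp: p_def poly_prod)
  then have "(\<Sum>j<n. hom (c $ j) * y ^ j * poly p (z ^ j))
      = (\<Sum>j\<in>{k}. hom (c $ j) * y ^ j * poly p (z ^ j))"
    using k by (intro sum.mono_neutral_right) auto
  ultimately have "poly p (z ^ k) = 0" using k y by simp
  then obtain j where "j \<in> ?A - {k}" "z ^ k = z ^ j" by (auto simp: p_def poly_prod)
  with inj k show False by (auto simp: inj_on_def)
qed

text \<open>The vector below represents \<open>x\<^sup>s c(x)\<close> modulo \<open>x\<^sup>n + 1\<close>.\<close>

lemma negacyclic_shift_zero_code:
  assumes c: "c \<in> zero_code hom n S" and S: "\<And>x. x \<in> S \<Longrightarrow> x ^ n = - 1" and s: "s < n"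
  shows "vec n (\<lambda>j. if s \<le> j then c $ (j - s) else - c $ (n + j - s)) \<in> zero_code hom n S" (is "?d \<in> _")
proof -
  have "(\<Sum>j<n. hom (?d $ j) * x ^ j) = 0" if x: "x \<in> S" for x
  proof -
    have "(\<Sum>j<n. hom (?d $ j) * x ^ j) = (\<Sum>i<n. hom (c $ i) * x ^ (s + i))"
    proof (rule sum.reindex_bij_witness[of _ "\<lambda>i. if i + s < n then i + s else i + s - n"
          "\<lambda>j. if s \<le> j then j - s else n + j - s"])
      fix j assume "j \<in> {..<n}"
      \<comment> \<open>For the wrapped indices, x^n = -1 cancels the sign built into the shifted
        vector.\<close>
      moreover have "x ^ (s + (n + j - s)) = - (x ^ j)" if "j < s"
        using that s S[OF x] by (simp add: power_add)
      ultimately show "hom (c $ (if s \<le> j then j - s else n + j - s)) *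
          x ^ (s + (if s \<le> j then j - s else n + j - s)) = hom (?d $ j) * x ^ j"
        by (auto simp: hom_distribs)
    qed (use s in auto)
    also have "\<dots> = x ^ s * (\<Sum>i<n. hom (c $ i) * x ^ i)"
      unfolding sum_distrib_left by (simp add: power_add ac_simps)
    also have "\<dots> = 0" using c x by (simp add: zero_code_def)
    finally show ?thesis .
  qed
  then show ?thesis by (simp add: zero_code_def)
qed

text \<open>Summing the relations \<open>v \<bottom> x\<^sup>s c\<close> with weights \<open>x\<^bsup>-s\<^esup>\<close> gives \<open>v(x\<^bsup>-1\<^esup>) c(x) = 0\<close>.\<close>

lemma dual_code_zero_code_subset:
  assumes S: "\<And>x. x \<in> S \<Longrightarrow> x ^ n = - 1"
    and c: "c \<in> zero_code hom n S" "(\<Sum>j<n. hom (c $ j) * x ^ j) \<noteq> 0"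
    and x: "x ^ n = - 1" and v: "v \<in> dual_code n (zero_code hom n S)"
  shows "(\<Sum>j<n. hom (v $ j) * inverse x ^ j) = 0"
proof -
  let ?y = "inverse x"
  have n: "n > 0" using c(2) by (cases n) auto
  have x0: "x \<noteq> 0" using x n by (auto simp: power_0_left)
  have y: "?y ^ n = - 1" using x by (simp add: power_inverse)
  let ?d = "\<lambda>s. vec n (\<lambda>j. if s \<le> j then c $ (j - s) else - c $ (n + j - s))"
  \<comment> \<open>Coordinatewise, the weighted sum of the shifts is a power of \<open>?y\<close>
    times the value c(x), which can therefore be factored out.\<close>
  have rot: "(\<Sum>s<n. ?y ^ s * hom (?d s $ j)) = ?y ^ j * (\<Sum>i<n. hom (c $ i) * x ^ i)"
    if j: "j < n" for j
  proof -
    have "(\<Sum>s<n. ?y ^ s * hom (?d s $ j)) = (\<Sum>i<n. ?y ^ j * (hom (c $ i) * x ^ i))"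
    proof (rule sum.reindex_bij_witness[of _ "\<lambda>i. if i \<le> j then j - i else n + j - i"
          "\<lambda>s. if s \<le> j then j - s else n + j - s"])
      fix s assume "s \<in> {..<n}"
      then have s: "s < n" by simp
      have 1: "?y ^ j * x ^ (j - s) = ?y ^ s" if "s \<le> j"
      proof -
        have "?y ^ j = ?y ^ s * ?y ^ (j - s)" using that by (simp flip: power_add)
        then show ?thesis using x0 by (simp add: power_inverse)
      qed
      have 2: "?y ^ j * x ^ (n + j - s) = - (?y ^ s)" if "j < s"
      proof -
        have "?y ^ n * ?y ^ j = ?y ^ s * ?y ^ (n + j - s)" using that s by (simp flip: power_add)
        then have "- (?y ^ n * ?y ^ j) = - (?y ^ s * ?y ^ (n + j - s))" by (rule arg_cong)
        then have "?y ^ j = - (?y ^ s) * ?y ^ (n + j - s)" by (simp add: y)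
        then show ?thesis using x0 by (simp add: power_inverse)
      qed
      show "?y ^ j * (hom (c $ (if s \<le> j then j - s else n + j - s)) *
          x ^ (if s \<le> j then j - s else n + j - s)) = ?y ^ s * hom (?d s $ j)"
        using j by (auto simp: 1 2 hom_distribs mult.left_commute[of "?y ^ j"] mult.commute[of "?y ^ s"])
    qed (use j in auto)
    then show ?thesis by (simp add: sum_distrib_left)
  qed
  have "hom (v \<bullet> ?d s) = 0" if "s < n" for s
  proof -
    have "?d s \<in> zero_code hom n S" using c(1) S that by (rule negacyclic_shift_zero_code)
    then show ?thesis using v by (simp add: dual_code_def)
  qed
  then have "0 = (\<Sum>s<n. ?y ^ s * hom (v \<bullet> ?d s))" by simp
  also have "\<dots> = (\<Sum>s<n. \<Sum>j<n. hom (v $ j) * (?y ^ s * hom (?d s $ j)))"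
    by (intro sum.cong refl) (simp add: scalar_prod_def hom_distribs sum_distrib_left lessThan_atLeast0 ac_simps del: index_vec)
  also have "\<dots> = (\<Sum>j<n. hom (v $ j) * (\<Sum>s<n. ?y ^ s * hom (?d s $ j)))"
    by (subst sum.swap) (simp add: sum_distrib_left del: index_vec)
  also have "\<dots> = (\<Sum>j<n. hom (v $ j) * ?y ^ j) * (\<Sum>i<n. hom (c $ i) * x ^ i)"
    unfolding sum_distrib_right by (intro sum.cong refl) (simp add: rot mult.assoc del: index_vec)
  finally show ?thesis using c(2) by simp
qed

text \<open>For each \<open>x\<close> in \<open>R\<close> one of c(x) and v(1/x) vanishes. Summing
  the products over \<open>R\<close>, orthogonality leaves \<open>n\<close> times the inner product,
  and \<open>n\<close> is invertible.\<close>

lemma zero_code_subset_dual_code: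
  assumes R: "card R = n" "\<And>x. x \<in> R \<Longrightarrow> x ^ n = - 1" and n: "of_nat n \<noteq> (0 :: 'b)"
    and orth: "\<And>i j. i < n \<Longrightarrow> j < n \<Longrightarrow> i \<noteq> j \<Longrightarrow> (\<Sum>x\<in>R. x ^ i * inverse x ^ j) = 0"
    and S: "S \<subseteq> R"
  shows "zero_code hom n (inverse ` (R - S)) \<subseteq> dual_code n (zero_code hom n S)"
proof -
  have "n > 0" using n by (cases n) auto
  have R0: "x \<noteq> 0" if "x \<in> R" for x using R(2)[OF that] \<open>n > 0\<close> by (auto simp: power_0_left)
  have diag: "(\<Sum>x\<in>R. x ^ i * inverse x ^ i) = of_nat n" for i
    using R(1) R0 by (simp add: power_inverse)
  have "v \<bullet> c = 0" if v: "v \<in> zero_code hom n (inverse ` (R - S))" and c: "c \<in> zero_code hom n S" for v c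
  proof -
    have "(\<Sum>i<n. hom (c $ i) * x ^ i) * (\<Sum>j<n. hom (v $ j) * inverse x ^ j) = 0" if "x \<in> R" for x
      using v c that by (cases "x \<in> S") (auto simp: zero_code_def)
    then have "0 = (\<Sum>x\<in>R. (\<Sum>i<n. hom (c $ i) * x ^ i) * (\<Sum>j<n. hom (v $ j) * inverse x ^ j))"
      by simp
    also have "\<dots> = (\<Sum>x\<in>R. \<Sum>i<n. \<Sum>j<n. hom (c $ i) * hom (v $ j) * (x ^ i * inverse x ^ j))"
      by (simp add: sum_product ac_simps)
    also have "\<dots> = (\<Sum>i<n. \<Sum>j<n. hom (c $ i) * hom (v $ j) * (\<Sum>x\<in>R. x ^ i * inverse x ^ j))"
      by (subst sum.swap, intro sum.cong refl, subst sum.swap) (simp add: sum_distrib_left)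
    also have "\<dots> = (\<Sum>i<n. \<Sum>j<n. if i = j then hom (c $ i) * hom (v $ i) * of_nat n else 0)"
      by (intro sum.cong refl) (auto simp: orth diag)
    also have "\<dots> = (\<Sum>i<n. hom (c $ i) * hom (v $ i)) * of_nat n"
      by (simp add: sum_distrib_right)
    also have "(\<Sum>i<n. hom (c $ i) * hom (v $ i)) = hom (v \<bullet> c)"
    proof -
      have "dim_vec c = n" using c by (auto simp: zero_code_def)
      then show ?thesis by (simp add: scalar_prod_def hom_distribs lessThan_atLeast0 mult.commute)
    qed
    finally show ?thesis using n by simp
  qed
  then show ?thesis by (auto simp: dual_code_def zero_code_def)
qed

end

lemma min_distance_ge:
  fixes C :: "'a::ab_group_add vec set"
  assumes C: "C \<subseteq> carrier_vec n" and diff: "\<And>c d. c \<in> C \<Longrightarrow> d \<in> C \<Longrightarrow> c - d \<in> C"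
    and nontriv: "c \<in> C" "c \<noteq> 0\<^sub>v n"
    and wt: "\<And>c. c \<in> C \<Longrightarrow> c \<noteq> 0\<^sub>v n \<Longrightarrow> d \<le> card {j. j < n \<and> c $ j \<noteq> 0}"
  shows "d \<le> min_distance C"
proof -
  let ?D = "{hamming_distance u v | u v. u \<in> C \<and> v \<in> C \<and> u \<noteq> v}"
  have ham: "hamming_distance u v = card {j. j < n \<and> (u - v) $ j \<noteq> 0}" if "u \<in> C" "v \<in> C" for u v
  proof -
    have "dim_vec u = n" "dim_vec v = n" using that C by auto
    then show ?thesis by (auto simp: hamming_distance_def intro!: arg_cong[of _ _ card])
  qed
  have le: "card {j. j < n \<and> u $ j \<noteq> v $ j} \<le> n" for u v :: "'a vec"
    using card_mono[of "{..<n}" "{j. j < n \<and> u $ j \<noteq> v $ j}"] by auto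
  have "?D \<subseteq> {..n}" using le C by (auto simp: hamming_distance_def)
  then have "finite ?D" by (rule finite_subset) simp
  \<comment> \<open>The zero word and \<open>c\<close> are two distinct codewords, so
    \<open>Min\<close> is taken over a nonempty set.\<close>
  moreover have "c - c \<in> C" "c - c \<noteq> c"
    using diff nontriv C by (auto simp: subset_iff)
  then have "?D \<noteq> {}" using nontriv by blast
  moreover have "d \<le> e" if e: "e \<in> ?D" for e
  proof -
    obtain u v where uv: "e = hamming_distance u v" "u \<in> C" "v \<in> C" "u \<noteq> v" using e by blast
    then have dim: "dim_vec u = n" "dim_vec v = n" using C by auto
    have "u - v \<noteq> 0\<^sub>v n"
    proof
      assume "u - v = 0\<^sub>v n"
      then have "(u - v) $ j = 0" if "j < n" for j using that by simp
      then have "u = v" using dim by (intro eq_vecI) auto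
      with uv show False by simp
    qed
    with uv show ?thesis using wt[OF diff] ham by simp
  qed
  ultimately show ?thesis unfolding min_distance_def by simp
qed

subsection \<open>Primitive elements and generators\<close>

text \<open>In the field 2n + 1 = 0, so n = 0 would give 1 = 0.\<close>

lemma of_nat_half_card_neq_0:
  assumes n: "CARD('b::{field,finite}) = 2 * n + 1"
  shows "of_nat n \<noteq> (0 :: 'b)"
proof
  assume "of_nat n = (0 :: 'b)"
  moreover have "of_nat (2 * n + 1) = (0 :: 'b)" using of_nat_card_eq_0[where 'a='b] n by simp
  ultimately show False by simp
qed

context
  fixes \<beta> :: "'b::{field,finite}"
  assumes \<beta>: "primitive_element \<beta>"
begin

lemma primitive_element_pow_card: "\<beta> ^ (CARD('b) - 1) = 1"
proof -
  have "\<beta> * \<beta> ^ (CARD('b) - 1) = \<beta> * 1"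
    using finite_field_pow_card[of \<beta>] power_Suc[of \<beta> "CARD('b) - 1"] by simp
  then show ?thesis using \<beta> by (simp only: mult_cancel_left) (simp add: primitive_element_def)
qed

lemma primitive_element_pow_mod: "\<beta> ^ (i mod (CARD('b) - 1)) = \<beta> ^ i"
proof -
  have "\<beta> ^ i = \<beta> ^ (i mod (CARD('b) - 1) + (CARD('b) - 1) * (i div (CARD('b) - 1)))" by simp
  also have "\<dots> = \<beta> ^ (i mod (CARD('b) - 1))"
    unfolding power_add power_mult primitive_element_pow_card by simp
  finally show ?thesis ..
qed

text \<open>These powers exhaust the nonzero elements, of which there are equally many, so none
  repeats.\<close>

lemma inj_on_primitive_element_pow: "inj_on (\<lambda>i. \<beta> ^ i) {..<CARD('b) - 1}"
proof (rule eq_card_imp_inj_on)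
  have card: "card (UNIV - {0 :: 'b}) = CARD('b) - 1" by (simp add: card_Diff_singleton)
  have "card {0, 1 :: 'b} \<le> CARD('b)" by (rule card_mono) auto
  then have pos: "CARD('b) - 1 > 0" by simp
  have "(\<lambda>i. \<beta> ^ i) ` {..<CARD('b) - 1} = UNIV - {0}"
  proof (intro equalityI subsetI)
    fix x :: 'b assume "x \<in> UNIV - {0}"
    then obtain i where "x = \<beta> ^ i" using \<beta> by (auto simp: primitive_element_def)
    then have "x = \<beta> ^ (i mod (CARD('b) - 1))" by (simp only: primitive_element_pow_mod)
    then show "x \<in> (\<lambda>i. \<beta> ^ i) ` {..<CARD('b) - 1}"
      using pos by (intro image_eqI) auto
  qed (use \<beta> in \<open>auto simp: primitive_element_def\<close>)
  then show "card ((\<lambda>i. \<beta> ^ i) ` {..<CARD('b) - 1}) = card {..<CARD('b) - 1}"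
    using card by simp
qed simp

context
  fixes n :: nat
  assumes n: "CARD('b) = 2 * n + 1"
begin

text \<open>This power is a square root of 1 different from 1.\<close>

lemma primitive_element_pow_half: "\<beta> ^ n = - 1"
proof -
  have "card {0, 1 :: 'b} \<le> CARD('b)" by (rule card_mono) auto
  then have n0: "n > 0" using n by simp
  have "(\<beta> ^ n)\<^sup>2 = 1"
    using primitive_element_pow_card n by (simp add: mult.commute flip: power_mult)
  moreover have "\<beta> ^ n \<noteq> 1"
  proof
    assume "\<beta> ^ n = 1"
    then have "\<beta> ^ n = \<beta> ^ 0" by simp
    then have "n = 0" by (rule inj_onD[OF inj_on_primitive_element_pow]) (use n n0 in auto)
    with n0 show False by simp
  qed
  ultimately show ?thesis by (simp add: power2_eq_1_iff)
qed

lemma inj_on_pow_Omega: "inj_on (\<lambda>i. \<beta> ^ i) (Omega n)"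
  by (rule inj_on_subset[OF inj_on_primitive_element_pow]) (auto simp: n Omega_def)

lemma pow_Omega_pow: "i \<in> Omega n \<Longrightarrow> (\<beta> ^ i) ^ n = - 1"
proof -
  assume "i \<in> Omega n"
  then have "odd i" by (auto simp: Omega_def)
  have "(\<beta> ^ i) ^ n = (\<beta> ^ n) ^ i" by (simp add: mult.commute flip: power_mult)
  with \<open>odd i\<close> show "(\<beta> ^ i) ^ n = - 1" by (simp add: primitive_element_pow_half)
qed

text \<open>Over odd exponents the sum is \<open>u\<close> times a geometric series in
  \<open>u\<^sup>2\<close>, where u = beta^(i - j). Its ratio is an \<open>n\<close>-th root of
  unity, different from 1 because \<open>i\<close> and \<open>j\<close> are distinct and below
  \<open>n\<close>.\<close>

lemma sum_pow_Omega_orthogonal: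
  assumes "i < n" "j < n" "i \<noteq> j"
  shows "(\<Sum>x\<in>(\<lambda>h. \<beta> ^ h) ` Omega n. x ^ i * inverse x ^ j) = 0"
proof -
  define u where "u = \<beta> ^ i * inverse \<beta> ^ j"
  have \<beta>0: "\<beta> \<noteq> 0" using \<beta> by (simp add: primitive_element_def)
  have u2: "u\<^sup>2 \<noteq> 1"
  proof
    assume "u\<^sup>2 = 1"
    then have "\<beta> ^ (2 * i) = \<beta> ^ (2 * j)"
      using \<beta>0 by (simp add: u_def power_mult_distrib power_inverse field_simps flip: power_mult)
    then have "2 * i = 2 * j"
      by (rule inj_onD[OF inj_on_primitive_element_pow]) (use assms n in auto)
    with assms show False by simp
  qed
  have "u ^ (2 * n) = (\<beta> ^ (2 * n)) ^ i * inverse (\<beta> ^ (2 * n)) ^ j"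
    unfolding u_def by (simp add: power_mult_distrib power_inverse ac_simps flip: power_mult)
  also have "\<beta> ^ (2 * n) = 1" using primitive_element_pow_card n by simp
  finally have un: "(u\<^sup>2) ^ n = 1" by (simp flip: power_mult)
  have Om: "Omega n = (\<lambda>l. 1 + 2 * l) ` {..<n}" by (auto simp: Omega_def)
  have "(\<Sum>x\<in>(\<lambda>h. \<beta> ^ h) ` Omega n. x ^ i * inverse x ^ j)
      = (\<Sum>h\<in>Omega n. (\<beta> ^ h) ^ i * inverse (\<beta> ^ h) ^ j)"
    by (subst sum.reindex[OF inj_on_pow_Omega]) simp
  also have "\<dots> = (\<Sum>h\<in>Omega n. u ^ h)"
    by (intro sum.cong refl)
      (simp add: u_def power_mult_distrib power_inverse mult.commute flip: power_mult)
  also have "\<dots> = (\<Sum>l<n. u * (u\<^sup>2) ^ l)"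
    unfolding Om by (subst sum.reindex) (auto simp: inj_on_def power_mult)
  also have "\<dots> = 0"
    using geometric_sum[OF u2, of n] un by (simp flip: sum_distrib_left)
  finally show ?thesis .
qed

end

end

text \<open>Injectivity of \<open>map_poly hom\<close> gives the uniqueness demanded by
  \<open>THE\<close>; injectivity on \<open>Z\<close> lets the product run over field elements
  instead of exponents.\<close>

lemma (in field_hom) map_poly_generator_poly:
  assumes "\<exists>g. map_poly hom g = (\<Prod>x\<in>(\<lambda>i. \<beta> ^ i) ` Z. [:- x, 1:])" "inj_on (\<lambda>i. \<beta> ^ i) Z"
  shows "map_poly hom (generator_poly hom \<beta> Z) = (\<Prod>x\<in>(\<lambda>i. \<beta> ^ i) ` Z. [:- x, 1:])"
proof -
  interpret MP: map_poly_inj_idom_hom hom ..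
  have eq: "(\<Prod>x\<in>(\<lambda>i. \<beta> ^ i) ` Z. [:- x, 1:]) = (\<Prod>i\<in>Z. [:- (\<beta> ^ i), 1:])"
    by (subst prod.reindex[OF assms(2)]) simp
  obtain g where g: "map_poly hom g = (\<Prod>i\<in>Z. [:- (\<beta> ^ i), 1:])" using assms(1) eq by auto
  have "generator_poly hom \<beta> Z = g"
    unfolding generator_poly_def
  proof (rule the_equality)
    show "map_poly hom g = (\<Prod>i\<in>Z. [:- (\<beta> ^ i), 1:])" by (rule g)
  next
    fix f assume "map_poly hom f = (\<Prod>i\<in>Z. [:- (\<beta> ^ i), 1:])"
    then have "map_poly hom f = map_poly hom g" by (simp only: g)
    then show "f = g" by (simp only: MP.eq_iff)
  qed
  then show ?thesis using g eq by simp
qed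

text \<open>The coefficient vector of \<open>g\<close> itself serves: it fits into length
  \<open>n\<close> and vanishes on \<open>S\<close> only.\<close>

lemma (in field_hom) ex_codeword_nonzero_at:
  assumes S: "finite S" "card S < n" "x \<notin> S"
    and g: "map_poly hom g = (\<Prod>x\<in>S. [:- x, 1:])"
  shows "\<exists>c\<in>zero_code hom n S. (\<Sum>j<n. hom (c $ j) * x ^ j) \<noteq> 0"
proof
  have "degree g = card S" using g degree_map_poly_hom[of g] degree_prod_linear by metis
  also have "\<dots> < n" by (rule S)
  finally have cw: "codeword_poly n (vec n (coeff g)) = g"
    by (intro codeword_poly_vec_coeff) (auto simp: coeff_eq_0)
  then show "vec n (coeff g) \<in> zero_code hom n S"
    using S g by (simp add: mem_zero_code_iff_dvd)
  have "(\<Sum>j<n. hom (vec n (coeff g) $ j) * x ^ j) = poly (map_poly hom g) x"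
    using poly_map_codeword_poly[of n "vec n (coeff g)" x] cw by simp
  also have "\<dots> \<noteq> 0" using S unfolding g by (auto simp: poly_prod)
  finally show "(\<Sum>j<n. hom (vec n (coeff g) $ j) * x ^ j) \<noteq> 0" .
qed

lemma (in field_hom) zero_code_nontrivial:
  assumes "finite S" "card S < n" "map_poly hom g = (\<Prod>x\<in>S. [:- x, 1:])" "S \<noteq> UNIV"
  shows "\<exists>c\<in>zero_code hom n S. c \<noteq> 0\<^sub>v n"
proof -
  obtain x where "x \<notin> S" using assms(4) by blast
  then obtain c where c: "c \<in> zero_code hom n S" "(\<Sum>j<n. hom (c $ j) * x ^ j) \<noteq> 0"
    using ex_codeword_nonzero_at[OF assms(1,2) _ assms(3)] by blast
  then have "c \<noteq> 0\<^sub>v n" by auto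
  with c show ?thesis by blast
qed

lemma (in field_hom) dual_code_zero_code:
  assumes R: "finite R" "card R = n" "\<And>x. x \<in> R \<Longrightarrow> x ^ n = - 1" and n: "of_nat n \<noteq> (0 :: 'b)"
    and orth: "\<And>i j. i < n \<Longrightarrow> j < n \<Longrightarrow> i \<noteq> j \<Longrightarrow> (\<Sum>x\<in>R. x ^ i * inverse x ^ j) = 0"
    and S: "S \<subseteq> R" and g: "map_poly hom g = (\<Prod>x\<in>S. [:- x, 1:])"
  shows "dual_code n (zero_code hom n S) = zero_code hom n (inverse ` (R - S))"
proof
  show "zero_code hom n (inverse ` (R - S)) \<subseteq> dual_code n (zero_code hom n S)"
    using assms by (intro zero_code_subset_dual_code) auto
  show "dual_code n (zero_code hom n S) \<subseteq> zero_code hom n (inverse ` (R - S))"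
  proof
    fix v assume v: "v \<in> dual_code n (zero_code hom n S)"
    have "(\<Sum>j<n. hom (v $ j) * inverse x ^ j) = 0" if x: "x \<in> R - S" for x
    proof -
      have "finite S" "card S < n"
        using R(1,2) S x by (auto intro: finite_subset psubset_card_mono)
      then obtain c where c: "c \<in> zero_code hom n S" "(\<Sum>j<n. hom (c $ j) * x ^ j) \<noteq> 0"
        using ex_codeword_nonzero_at[OF _ _ _ g, of n x] x by blast
      show ?thesis
        by (rule dual_code_zero_code_subset[OF _ c _ v]) (use R(3) S x in auto)
    qed
    then show "v \<in> zero_code hom n (inverse ` (R - S))"
      using v by (auto simp: zero_code_def dual_code_def)
  qed
qed

lemma (in field_hom) min_distance_zero_code_ge:
  fixes z y :: 'b
  assumes nontriv: "\<exists>c\<in>zero_code hom n S. c \<noteq> 0\<^sub>v n"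
    and "\<And>a. a < \<delta> \<Longrightarrow> y * z ^ a \<in> S" "y \<noteq> 0" "inj_on (\<lambda>j. z ^ j) {..<n}"
  shows "\<delta> + 1 \<le> min_distance (zero_code hom n S)"
proof -
  obtain c where "c \<in> zero_code hom n S" "c \<noteq> 0\<^sub>v n" using nontriv by blast
  moreover have "\<delta> + 1 \<le> card {j. j < n \<and> c $ j \<noteq> 0}"
    if "c \<in> zero_code hom n S" "c \<noteq> 0\<^sub>v n" for c
  proof -
    have "\<delta> < card {j. j < n \<and> c $ j \<noteq> 0}"
      by (rule BCH_bound[OF that _ assms(3,4)]) (rule assms(2))
    then show ?thesis by simp
  qed
  ultimately show ?thesis
    by (intro min_distance_ge[of _ n]) (auto simp: zero_code_diff, auto simp: zero_code_def)
qed

theorem theorem9: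
  fixes q m n :: nat
    and \<phi> :: "'a::{field,finite} \<Rightarrow> 'b::{field,finite}"
    and \<beta> :: 'b
    and C :: "'a vec set"
  assumes "\<exists>p k. prime p \<and> k \<ge> 1 \<and> q = p ^ k" and "odd q"
    and "m \<ge> 3" and "odd m"
    and "n = (q ^ m - 1) div 2"
    and "CARD('a) = q" and "CARD('b) = q ^ m"
    and "field_hom \<phi>"
    and "primitive_element \<beta>"
    and "C = C_code m \<phi> \<beta> 1 n"
  shows "negacyclic_code n C
    \<and> real (code_dim n C) = (real q ^ m + (2 - real q) ^ m - 2) / 4
    \<and> min_distance C \<ge> q ^ ((m - 1) div 2) + 1 + (if q = 3 then 0 else q - 2)
    \<and> linear_code n (dual_code n C)
    \<and> real (code_dim n (dual_code n C)) = (real q ^ m - (2 - real q) ^ m) / 4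
    \<and> min_distance (dual_code n C) \<ge> (q - 1) * q ^ ((m - 3) div 2) + 1"
proof -
  interpret field_hom \<phi> by fact
  interpret finite_field_extension \<phi>
    using assms by unfold_locales auto
  have q3: "q \<ge> 3"
  proof -
    have "card {0, 1 :: 'a} \<le> CARD('a)" by (rule card_mono) auto
    then show ?thesis using assms(2,6) by (cases "q = 2") auto
  qed
  \<comment> \<open>Here \<open>l\<close> is the exponent (m - 3)/2 of the dual bound, and
    \<open>k = l + 1\<close> is the exponent (m - 1)/2 of the other.\<close>
  obtain l where m: "m = 2 * l + 3"
  proof -
    obtain j where "m = 2 * j + 1" using \<open>odd m\<close> by (elim oddE)
    then show thesis using \<open>m \<ge> 3\<close> by (intro that[of "j - 1"]) auto
  qed
  define k where "k = Suc l"
  have mk: "m = 2 * k + 1" by (simp add: m k_def)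
  have nk: "n = (q ^ (2 * k + 1) - 1) div 2" using assms(5) unfolding mk .
  have qm: "odd (q ^ m)" using \<open>odd q\<close> by simp
  then have qn: "q ^ m = 2 * n + 1" unfolding assms(5) by simp
  have cardb: "CARD('b) = 2 * n + 1" using qn assms(7) by simp
  have N: "CARD('b) - 1 = q ^ m - 1" using assms(7) by simp
  note prim = assms(9)
  have \<beta>0: "\<beta> \<noteq> 0" using prim by (simp add: primitive_element_def)

  \<comment> \<open>Zeros of the code and of its dual\<close>
  define P where "P = (\<lambda>Z. (\<lambda>i. \<beta> ^ i) ` Z)"
  let ?T = "\<lambda>i. T_set q m i n"
  let ?R = "P (Omega n)" and ?S = "P (?T 1)"
  have T_sub: "?T i \<subseteq> Omega n" for i by (auto simp: T_set_def)
  have cardO: "card (Omega n) = n"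
  proof -
    have "Omega n = (\<lambda>i. 1 + 2 * i) ` {..<n}" by (auto simp: Omega_def)
    then show ?thesis by (simp add: card_image inj_on_def)
  qed
  have inj: "inj_on (\<lambda>i. \<beta> ^ i) (Omega n)" by (rule inj_on_pow_Omega[OF prim cardb])
  have injT: "inj_on (\<lambda>i. \<beta> ^ i) (?T i)" for i using inj T_sub by (rule inj_on_subset)
  have finO: "finite (Omega n)" by (simp add: Omega_def)
  have R: "finite ?R" "card ?R = n" "\<And>x. x \<in> ?R \<Longrightarrow> x ^ n = - 1"
    using finO card_image[OF inj] cardO pow_Omega_pow[OF prim cardb] by (auto simp: P_def)
  have S: "?S \<subseteq> ?R" using T_sub by (auto simp: P_def)
  have RS: "?R - ?S = P (?T 0)"
  proof -
    have "?R - ?S = P (Omega n - ?T 1)"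
      unfolding P_def by (rule inj_on_image_set_diff[symmetric, OF inj]) (use T_sub in auto)
    also have "Omega n - ?T 1 = ?T 0" by (auto simp: T_set_def)
    finally show ?thesis .
  qed
  have closed: "x ^ CARD('a) \<in> P (?T i)" if x: "x \<in> P (?T i)" for x i
  proof -
    obtain h where h: "x = \<beta> ^ h" "h \<in> ?T i" using x by (auto simp: P_def)
    have "x ^ CARD('a) = \<beta> ^ ((q * h) mod (q ^ m - 1))"
      unfolding h(1) N[symmetric] primitive_element_pow_mod[OF prim]
      by (simp add: assms(6) mult.commute flip: power_mult)
    moreover have "(q * h) mod (q ^ m - 1) \<in> ?T i"
      using assms h(2) by (intro T_set_mult_mod) auto
    ultimately show ?thesis by (auto simp: P_def)
  qed
  obtain g where g: "map_poly \<phi> g = (\<Prod>x\<in>?S. [:- x, 1:])"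
    using ex_map_poly_eq_prod_linear[of ?S] closed by blast
  have gen: "map_poly \<phi> (generator_poly \<phi> \<beta> (?T 1)) = (\<Prod>x\<in>?S. [:- x, 1:])"
    using map_poly_generator_poly[OF _ injT[of 1]] g unfolding P_def by blast
  have C_gen: "C = code_generated_by n (generator_poly \<phi> \<beta> (?T 1))"
    using assms(6,10) by (simp add: C_code_def code_with_defining_set_def)
  also have "\<dots> = zero_code \<phi> n ?S"
    by (rule code_generated_by_eq_zero_code) (use S R gen finite_subset in auto)
  finally have C: "C = zero_code \<phi> n ?S" .
  let ?S' = "inverse ` P (?T 0)"
  have dual: "dual_code n C = zero_code \<phi> n ?S'"
    unfolding C RS[symmetric]
  proof (rule dual_code_zero_code[OF R of_nat_half_card_neq_0[OF cardb] _ S g])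
    show "(\<Sum>x\<in>?R. x ^ i * inverse x ^ j) = 0" if "i < n" "j < n" "i \<noteq> j" for i j
      unfolding P_def using that by (rule sum_pow_Omega_orthogonal[OF prim cardb])
  qed
  \<comment> \<open>Inversion commutes with the Frobenius map.\<close>
  have closed': "x ^ CARD('a) \<in> ?S'" if "x \<in> ?S'" for x
    using that closed[of _ 0] by (auto simp: power_inverse)
  obtain g' where g': "map_poly \<phi> g' = (\<Prod>x\<in>?S'. [:- x, 1:])"
    using ex_map_poly_eq_prod_linear[of ?S'] closed' by blast

  \<comment> \<open>Dimensions\<close>
  have cardS: "card ?S = card (?T 1)" unfolding P_def by (rule card_image[OF injT])
  have cardS_le: "card ?S \<le> n" using card_mono[OF R(1) S] R(2) by simp
  have "card ?S' = card (?R - ?S)" unfolding RS by (rule card_image) (simp add: inj_on_def)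
  also have "\<dots> = n - card ?S" using R S by (simp add: card_Diff_subset finite_subset)
  finally have cardS': "card ?S' = n - card ?S" .
  have dim: "code_dim n C = n - card (?T 1)"
    unfolding C cardS[symmetric] using cardS_le S R g by (intro code_dim_zero_code) (auto intro: finite_subset)
  have dim': "code_dim n (dual_code n C) = card (?T 1)"
    unfolding dual using code_dim_zero_code[OF _ _ g', of n] cardS cardS' cardS_le R RS
    by (simp add: finite_subset)
  have "real_of_int (4 * int (card (?T 1))) = real_of_int (int q ^ m - (2 - int q) ^ m)"
    using card_T_set_odd[OF \<open>odd q\<close> assms(5)] by simp
  then have cardT: "4 * real (card (?T 1)) = real q ^ m - (2 - real q) ^ m" by simp
  have "real (q ^ m) = real (2 * n + 1)" using qn by simp
  then have rn: "real q ^ m = 2 * real n + 1" by simp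

  \<comment> \<open>Progressions of zeros and the distance bounds\<close>
  define Q where "Q = q ^ k"
  have Q2: "q ^ (2 * k) = Q * Q" by (simp add: Q_def mult_2 power_add)
  obtain A B where AB: "(Q + 1) * A = 2 + B * (q ^ m - 1)"
    using ex_multiple_eq_2_mod[of q k] q3 unfolding mk Q_def by auto
  let ?z = "\<beta> ^ (Q + 1)"
  have z: "inj_on (\<lambda>j. ?z ^ j) {..<n}"
  proof (rule inj_onI)
    fix i j assume ij: "i \<in> {..<n}" "j \<in> {..<n}" "?z ^ i = ?z ^ j"
    have zA: "?z ^ A = \<beta> ^ 2"
    proof -
      have "?z ^ A = \<beta> ^ (2 + B * (q ^ m - 1))" unfolding AB[symmetric] by (rule power_mult[symmetric])
      also have "\<dots> = \<beta> ^ 2 * (\<beta> ^ (q ^ m - 1)) ^ B"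
        unfolding power_add mult.commute[of B] power_mult ..
      also have "\<beta> ^ (q ^ m - 1) = 1" using primitive_element_pow_card[OF prim] unfolding N .
      finally show ?thesis by simp
    qed
    have "(?z ^ i) ^ A = (?z ^ j) ^ A" using ij by simp
    then have "(?z ^ A) ^ i = (?z ^ A) ^ j" by (simp only: power_mult[symmetric] ac_simps)
    then have "\<beta> ^ (2 * i) = \<beta> ^ (2 * j)" unfolding zA power_mult .
    then have "2 * i = 2 * j"
      by (rule inj_onD[OF inj_on_primitive_element_pow[OF prim]]) (use ij cardb in auto)
    then show "i = j" by simp
  qed
  have z': "inj_on (\<lambda>j. inverse ?z ^ j) {..<n}"
    using z unfolding inj_on_def power_inverse inverse_eq_iff_eq .

  \<comment> \<open>Starting at \<open>q ^ l\<close> makes the leading digit nonzero; exactly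
    \<open>(q - 1) * q ^ l\<close> numbers below \<open>q ^ Suc l\<close> qualify.\<close>
  have zeros': "q ^ (2 * l + 1) + (Q + 1) * (q ^ l + a) \<in> ?T 0" if "a < (q - 1) * q ^ l" for a
  proof -
    have "q ^ l + a < q ^ l + (q - 1) * q ^ l" using that by simp
    also have "\<dots> = q ^ Suc l" using q3 by (cases q) simp_all
    finally show ?thesis unfolding Q_def k_def m
      by (intro T_set_0_progression) (use assms m q3 in auto)
  qed
  define \<delta> where "\<delta> = Q + (if q = 3 then 0 else q - 2)"
  have "\<exists>e. \<forall>a<\<delta>. e + (Q + 1) * a \<in> ?T 1"
  proof (cases "q = 3")
    case True
    have "1 * q ^ (2 * k) + (q ^ k + 1) * a \<in> ?T 1" if "a < Q" for a
      unfolding mk by (rule T_set_1_progression[OF \<open>odd q\<close> nk]) (use q3 that in \<open>auto simp: Q_def\<close>)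
    then show ?thesis using True unfolding \<delta>_def Q_def by auto
  next
    case False
    with q3 \<open>odd q\<close> have q5: "q \<ge> 5" by presburger
    have "q \<le> Q" unfolding Q_def k_def using q3 by simp
    \<comment> \<open>The progression starts \<open>q - 2\<close> steps to the left of
      \<open>3 * (Q * Q)\<close>; this bound keeps the start \<open>e\<close> a natural number. The
      first \<open>q - 2\<close> terms lie left of that point, the other \<open>Q\<close> terms at
      it or to its right.\<close>
    then have "(q - 2) * (Q + 1) \<le> Q * (Q + 1)" by (intro mult_right_mono) auto
    also have "\<dots> \<le> 3 * (Q * Q)" using \<open>q \<le> Q\<close> q3 by (simp add: algebra_simps)
    finally obtain e where e: "e + (q - 2) * (Q + 1) = 3 * (Q * Q)" by (metis le_add_diff_inverse2)
    have "e + (Q + 1) * a \<in> ?T 1" if a: "a < \<delta>" for a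
    proof (cases "a < q - 2")
      case True
      define b where "b = q - 2 - a"
      have ab: "q - 2 = a + b" "b \<ge> 1" "b + 2 \<le> q" using True by (auto simp: b_def)
      have "e + (Q + 1) * a + (q ^ k + 1) * b = 3 * q ^ (2 * k)"
        using e unfolding ab(1) Q2 Q_def[symmetric] by (simp add: algebra_simps)
      from T_set_1_progression_left[OF \<open>odd q\<close> nk _ ab(2,3) _ this] show ?thesis
        unfolding mk using q3 k_def by simp
    next
      case False
      define b where "b = a - (q - 2)"
      have ab: "a = (q - 2) + b" "b < Q" using False a q5 by (auto simp: b_def \<delta>_def)
      have "e + (Q + 1) * a = 3 * q ^ (2 * k) + (q ^ k + 1) * b"
        using e unfolding ab(1) Q2 by (simp add: algebra_simps Q_def)
      also have "\<dots> \<in> ?T 1"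
        unfolding mk by (rule T_set_1_progression[OF \<open>odd q\<close> nk]) (use q5 ab in \<open>auto simp: Q_def\<close>)
      finally show ?thesis .
    qed
    then show ?thesis by blast
  qed
  then obtain e where e: "\<And>a. a < \<delta> \<Longrightarrow> e + (Q + 1) * a \<in> ?T 1" by blast
  have "Q > 0" unfolding Q_def using q3 by simp
  then have "\<delta> > 0" by (simp add: \<delta>_def)
  from e[OF \<open>\<delta> > 0\<close>] have S_ne: "?S \<noteq> {}" by (auto simp: P_def)
  have n0: "n > 0" using qn q3 m by (cases n) auto
  have finS: "finite ?S" using R(1) S by (rule rev_finite_subset)
  have zero_notin: "0 \<notin> ?S'" "0 \<notin> ?S" using \<beta>0 by (auto simp: P_def)

  have min': "(q - 1) * q ^ l + 1 \<le> min_distance (dual_code n C)"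
    unfolding dual
  proof (rule min_distance_zero_code_ge[OF _ _ _ z'])
    let ?e = "q ^ (2 * l + 1) + (Q + 1) * q ^ l"
    fix a assume "a < (q - 1) * q ^ l"
    from zeros'[OF this] have "?e + (Q + 1) * a \<in> ?T 0" by (simp only: distrib_left add.assoc)
    then have "inverse (\<beta> ^ (?e + (Q + 1) * a)) \<in> ?S'" by (auto simp: P_def)
    also have "inverse (\<beta> ^ (?e + (Q + 1) * a)) = inverse (\<beta> ^ ?e) * inverse ?z ^ a"
      unfolding power_add[of \<beta> ?e] power_mult[of \<beta> "Q + 1"] inverse_mult_distrib power_inverse ..
    finally show "inverse (\<beta> ^ ?e) * inverse ?z ^ a \<in> ?S'" .
  next
    show "\<exists>c\<in>zero_code \<phi> n ?S'. c \<noteq> 0\<^sub>v n"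
    proof (rule zero_code_nontrivial[OF _ _ g'])
      \<comment> \<open>A zero of the code itself is missing from the zeros of the dual, which is
        why the dual is nontrivial.\<close>
      show "card ?S' < n" unfolding cardS' using S_ne cardS_le n0 finS by (simp add: card_gt_0_iff)
      show "?S' \<noteq> UNIV" using zero_notin(1) by blast
    qed simp
  qed (use \<beta>0 in simp)

  have min: "\<delta> + 1 \<le> min_distance C"
    unfolding C
  proof (rule min_distance_zero_code_ge[OF _ _ _ z])
    fix a assume "a < \<delta>"
    from e[OF this] have "\<beta> ^ (e + (Q + 1) * a) \<in> ?S" by (auto simp: P_def)
    then show "\<beta> ^ e * ?z ^ a \<in> ?S" by (simp only: power_add power_mult)
  next
    show "\<exists>c\<in>zero_code \<phi> n ?S. c \<noteq> 0\<^sub>v n"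
    proof (rule zero_code_nontrivial[OF finS _ g])
      have "P (?T 0) \<noteq> {}" using zeros'[of 0] q3 by (auto simp: P_def)
      then have "?S \<subset> ?R" using S RS by blast
      then show "card ?S < n" using psubset_card_mono[OF R(1)] R(2) by simp
      show "?S \<noteq> UNIV" using zero_notin(2) by blast
    qed
  qed (use \<beta>0 in simp)
  show ?thesis
  proof (intro conjI)
    show "negacyclic_code n C"
      unfolding negacyclic_code_def using subspace_zero_code[of n ?S] ideal_code_generated_by[OF n0] C C_gen
      by metis
    show "linear_code n (dual_code n C)" unfolding dual by (rule subspace_zero_code)
    show "real (code_dim n C) = (real q ^ m + (2 - real q) ^ m - 2) / 4"
      unfolding dim using cardS cardS_le cardT rn by (simp add: of_nat_diff)
    show "real (code_dim n (dual_code n C)) = (real q ^ m - (2 - real q) ^ m) / 4"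
      unfolding dim' using cardT by simp
    show "min_distance C \<ge> q ^ ((m - 1) div 2) + 1 + (if q = 3 then 0 else q - 2)"
      using min unfolding \<delta>_def Q_def mk by simp
    show "min_distance (dual_code n C) \<ge> (q - 1) * q ^ ((m - 3) div 2) + 1"
      using min' unfolding m by simp
  qed
qed

end
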